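(* Let $\gamma$ be bounded with $\|\gamma_x\|_{L^\infty(\mathbb R)}<1$ and $\|\gamma_x\|_{H^{k+1}(\mathbb R)}\le C_1$. Then, for some $C>0$, $$C^{-1}\|\psi\circ(\mathrm{Id}-\gamma)-\phi\|_{H^k(\mathbb R)}-\|\gamma_x\|_{H^{k+1}(\mathbb R)}\le\|\psi-\phi\circ(\mathrm{Id}+\gamma)\|_{H^k(\mathbb R)}\le C\Big(\|\psi\circ(\mathrm{Id}-\gamma)-\phi\|_{H^k(\mathbb R)}+\|\gamma_x\|_{H^{k+1}(\mathbb R)}\Big).$$
   Context: Here $k\ge 0$ is an integer (the order of derivatives) and $\gamma:\mathbb R\to\mathbb R$ is a phase modulation; $\mathrm{Id}\pm\gamma$ denotes the map $x\mapsto x\pm\gamma(x)$ on $\mathbb R$. The function $\phi:\mathbb R\to\mathbb C$ is a smooth spatially periodic steady solution of the Lugiato–Lefever equation $\partial_t\psi=-i\beta\partial_x^2\psi-(1+i\alpha)\psi+i|\psi|^2\psi+F$ with $\alpha,\beta,F\in\mathbb R$, $F>0$, and $\psi:\mathbb R\to\mathbb C$ is a perturbed solution of the same equation. All functions are taken at a fixed time $t$, which is suppressed. The quantities $\psi\circ(\mathrm{Id}-\gamma)-\phi$ and $\psi-\phi\circ(\mathrm{Id}+\gamma)$ are the inverse-modulated and forward-modulated perturbations, respectively. *)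

theory Defs
  imports "HOL-Analysis.Analysis" "HOL-Probability.Essential_Supremum"
begin

definition dx :: "(real \<Rightarrow> 'a::real_normed_vector) \<Rightarrow> real \<Rightarrow> 'a" where
  "dx f = (\<lambda>x. vector_derivative f (at x))"

definition smooth :: "(real \<Rightarrow> 'a::real_normed_vector) \<Rightarrow> bool" where
  "smooth f \<longleftrightarrow> (\<forall>n x. (dx ^^ n) f differentiable (at x))"

definition test_function :: "(real \<Rightarrow> real) \<Rightarrow> bool" where
  "test_function \<eta> \<longleftrightarrow> smooth \<eta> \<and> bounded {x. \<eta> x \<noteq> 0}"

definition locally_integrable :: "(real \<Rightarrow> 'a::{banach, second_countable_topology}) \<Rightarrow> bool" where
  "locally_integrable f \<longleftrightarrow> (\<forall>a b. set_integrable lborel {a..b} f)"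

definition has_weak_derivative ::
    "nat \<Rightarrow> (real \<Rightarrow> 'a::{banach, second_countable_topology}) \<Rightarrow> (real \<Rightarrow> 'a) \<Rightarrow> bool" where
  "has_weak_derivative n f g \<longleftrightarrow>
     locally_integrable f \<and> locally_integrable g \<and>
     (\<forall>\<eta>. test_function \<eta> \<longrightarrow>
        (LINT x|lborel. (dx ^^ n) \<eta> x *\<^sub>R f x) = (-1) ^ n *\<^sub>R (LINT x|lborel. \<eta> x *\<^sub>R g x))"

text \<open>
  The \<open>H\<^sup>k\<close>-norm on the real line, with value \<open>\<infinity>\<close> exactly for functions outside \<open>H\<^sup>k\<close>.
  Weak derivatives are unique up to null sets, so all families \<open>D\<close> below give the same value;
  the infimum merely selects it, and yields \<open>\<infinity>\<close> if there is no such family.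
\<close>

definition sobolev_norm :: "nat \<Rightarrow> (real \<Rightarrow> 'a::{banach, second_countable_topology}) \<Rightarrow> ereal" where
  "sobolev_norm k f =
     (INF D \<in> {D. \<forall>j\<le>k. has_weak_derivative j f (D j) \<and> integrable lborel (\<lambda>x. (norm (D j x))\<^sup>2)}.
        ereal (sqrt (\<Sum>j\<le>k. LINT x|lborel. (norm (D j x))\<^sup>2)))"

definition Linf_norm :: "(real \<Rightarrow> 'a::real_normed_vector) \<Rightarrow> ereal" where
  "Linf_norm f = esssup lborel (\<lambda>x. ereal (norm (f x)))"

definition LLE_steady_periodic :: "real \<Rightarrow> real \<Rightarrow> real \<Rightarrow> (real \<Rightarrow> complex) \<Rightarrow> bool" where
  "LLE_steady_periodic \<alpha> \<beta> F \<phi> \<longleftrightarrow>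
     smooth \<phi> \<and> (\<exists>P>0. \<forall>x. \<phi> (x + P) = \<phi> x) \<and>
     (\<forall>x. 0 = - \<i> * of_real \<beta> * dx (dx \<phi>) x - (1 + \<i> * of_real \<alpha>) * \<phi> x
              + \<i> * of_real ((cmod (\<phi> x))\<^sup>2) * \<phi> x + of_real F)"

text \<open>
  Solutions of the Lugiato--Lefever equation on the time interval \<open>[0, T)\<close>, as functions of time
  and space. The equation is understood in the weak sense, integrated in time, so
  that classical, strong and mild solutions with locally integrable cube are all covered.
\<close>

definition LLE_solution :: "real \<Rightarrow> real \<Rightarrow> real \<Rightarrow> real \<Rightarrow> (real \<Rightarrow> real \<Rightarrow> complex) \<Rightarrow> bool" where
  "LLE_solution \<alpha> \<beta> F T \<psi> \<longleftrightarrow>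
     set_borel_measurable lborel ({0..<T} \<times> UNIV) (\<lambda>(t, x). \<psi> t x) \<and>
     (\<forall>b<T. \<forall>r. set_integrable lborel ({0..b} \<times> {-r..r}) (\<lambda>(t, x). (cmod (\<psi> t x)) ^ 3)) \<and>
     (\<forall>t\<in>{0..<T}. locally_integrable (\<psi> t)) \<and>
     (\<forall>\<eta> s t. test_function \<eta> \<longrightarrow> 0 \<le> s \<longrightarrow> s \<le> t \<longrightarrow> t < T \<longrightarrow>
        (LINT x|lborel. \<eta> x *\<^sub>R \<psi> t x) - (LINT x|lborel. \<eta> x *\<^sub>R \<psi> s x) =
        (LINT (\<tau>, x):{s..t} \<times> UNIV|lborel.
            - \<i> * of_real \<beta> * of_real (dx (dx \<eta>) x) * \<psi> \<tau> x
            + of_real (\<eta> x) *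
                (- (1 + \<i> * of_real \<alpha>) * \<psi> \<tau> x
                 + \<i> * of_real ((cmod (\<psi> \<tau> x))\<^sup>2) * \<psi> \<tau> x + of_real F)))"

end

theory Submission
  imports Defs
begin

text \<open>
  Write \<open>a = Id - \<gamma>\<close>, \<open>v = \<psi> \<circ> a - \<phi>\<close> for the inverse-modulated perturbation and
  \<open>w = \<psi> - \<phi> \<circ> (Id + \<gamma>)\<close> for the forward-modulated one. Since \<open>\<bar>\<gamma>'\<bar> \<le> \<theta> < 1\<close>, the map \<open>a\<close> is a
  diffeomorphism of the line, and substituting \<open>a x\<close> into \<open>w\<close> gives \<open>v = w \<circ> a + r\<close>, hence
  \<open>w = (v - r) \<circ> a\<^sup>-\<^sup>1\<close>, with the remainder \<open>r = \<phi> \<circ> c - \<phi>\<close> and \<open>c = (Id + \<gamma>) \<circ> (Id - \<gamma>)\<close>.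
  Both inequalities therefore follow from two facts. Composition with \<open>a\<close> and with \<open>a\<^sup>-\<^sup>1\<close> is bounded
  on \<open>H\<^sup>k\<close> (\<open>Hk_bound_comp\<close>), because the Sobolev embedding turns the bound on \<open>\<gamma>'\<close> in \<open>H\<^sup>k\<^sup>+\<^sup>1\<close> into
  uniform bounds on the first \<open>k\<close> derivatives of \<open>\<gamma>'\<close> (\<open>Hk_bound_imp_Ck_bound\<close>), and these are
  inherited by the derivative of the inverse (\<open>Ck_bound_inverse_function_deriv\<close>). The remainder \<open>r\<close> is
  bounded in \<open>H\<^sup>k\<close> by \<open>\<gamma>'\<close> (\<open>Hk_bound_phase_remainder\<close>): the map \<open>c\<close> differs from the identity by
  \<open>\<gamma> (x - \<gamma> x) - \<gamma> x\<close>, which is the integral of \<open>\<gamma>'\<close> over an interval of length at most \<open>M\<close> next to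
  \<open>x\<close>, hence is square integrable (\<open>L2_bound_displacement\<close>) although \<open>\<gamma>\<close> itself is merely bounded;
  and the derivative of \<open>\<phi> \<circ> c - \<phi>\<close> is \<open>\<phi>' \<circ> c - \<phi>'\<close> plus \<open>c' - 1\<close> times \<open>\<phi>' \<circ> c\<close>, so that induction
  on the order applies. Of \<open>\<phi>\<close> this needs that it is smooth with bounded derivatives, which holds as
  it is periodic.

  To have product rule and chain rule at hand, the estimates are made for everywhere defined
  representatives, each the indefinite integral of the next derivative (\<open>Hk_bound\<close>). The passage from
  weak derivatives to such representatives (\<open>sobolev_norm_less_imp\<close>) is the lemma of
  du Bois-Reymond, for which smooth cut-off functions are constructed; the way back
  (\<open>sobolev_norm_le\<close>) is integration by parts. What is kept track of in the
  constants is that they do not depend on \<open>\<gamma>\<close> and \<open>\<psi>\<close>.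
\<close>

section \<open>Locally absolutely continuous functions\<close>

lemma locally_integrable_measurable:
  fixes f :: "real \<Rightarrow> 'a::euclidean_space"
  assumes "locally_integrable f"
  shows "f \<in> borel_measurable borel"
proof (rule borel_measurable_LIMSEQ_metric)
  fix n :: nat
  have "set_integrable lborel {- real n..real n} f"
    using assms unfolding locally_integrable_def by blast
  from borel_measurable_integrable[OF this[unfolded set_integrable_def]]
  show "(\<lambda>x. indicat_real {- real n..real n} x *\<^sub>R f x) \<in> borel_measurable borel"
    by simp
next
  fix x :: real
  obtain N :: nat where N: "\<bar>x\<bar> \<le> real N"
    using real_arch_simple by blast
  have "\<forall>\<^sub>F n in sequentially. indicat_real {- real n..real n} x *\<^sub>R f x = f x"
    using eventually_ge_at_top[of N]
  proof eventually_elim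
    case (elim n)
    then have "real N \<le> real n" by simp
    then have "x \<in> {- real n..real n}" using N by (simp add: abs_le_iff)
    then show ?case by simp
  qed
  then show "(\<lambda>n. indicat_real {- real n..real n} x *\<^sub>R f x) \<longlonglongrightarrow> f x"
    by (rule tendsto_eventually)
qed

lemma locally_integrable_add:
  assumes "locally_integrable f" "locally_integrable g"
  shows "locally_integrable (\<lambda>x. f x + g x)"
  using assms unfolding locally_integrable_def by (auto intro: set_integral_add(1))

lemma locally_integrable_diff:
  assumes "locally_integrable f" "locally_integrable g"
  shows "locally_integrable (\<lambda>x. f x - g x)"
  using assms unfolding locally_integrable_def by (auto intro: set_integral_diff(1))

lemma locally_integrable_continuous:
  assumes "continuous_on UNIV f"
  shows "locally_integrable f"
  unfolding locally_integrable_def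
  using assms by (auto intro!: borel_integrable_atLeastAtMost' intro: continuous_on_subset)

lemma locally_integrable_prod:
  fixes p :: "real \<Rightarrow> 'b::euclidean_space" and f :: "real \<Rightarrow> 'a::euclidean_space"
    and prod :: "'b \<Rightarrow> 'a \<Rightarrow> 'c::euclidean_space"
  assumes prod: "bounded_bilinear prod"
    and p: "continuous_on UNIV p" and f: "locally_integrable f"
  shows "locally_integrable (\<lambda>x. prod (p x) (f x))"
  unfolding locally_integrable_def
proof (intro allI)
  fix a b :: real
  interpret bounded_bilinear prod by fact
  obtain K where K: "K > 0" "\<And>u v. norm (prod u v) \<le> norm u * norm v * K"
    using pos_bounded by blast
  have "bounded (p ` {a..b})"
    by (intro compact_imp_bounded compact_continuous_image compact_Icc continuous_on_subset[OF p]) auto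
  then obtain L where L: "L > 0" "\<And>x. x \<in> {a..b} \<Longrightarrow> norm (p x) \<le> L"
    unfolding bounded_pos by auto
  have [measurable]: "f \<in> borel_measurable borel" "p \<in> borel_measurable borel"
    using locally_integrable_measurable[OF f] borel_measurable_continuous_onI[OF p] by auto
  have [measurable]: "(\<lambda>x. prod (p x) (f x)) \<in> borel_measurable borel"
  proof -
    have "(\<lambda>z. prod (fst z) (snd z)) \<in> borel_measurable (borel :: ('b \<times> 'a) measure)"
      by (intro borel_measurable_continuous_onI continuous_on continuous_intros)
    then have "(\<lambda>z. prod (fst z) (snd z)) \<circ> (\<lambda>x. (p x, f x)) \<in> borel_measurable borel"
      by (intro measurable_comp) auto
    then show ?thesis by (simp add: o_def)
  qed
  have int: "integrable lborel (\<lambda>x. indicator {a..b} x *\<^sub>R f x)"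
    using f unfolding locally_integrable_def set_integrable_def by blast
  show "set_integrable lborel {a..b} (\<lambda>x. prod (p x) (f x))"
    unfolding set_integrable_def
  proof (rule Bochner_Integration.integrable_bound)
    show "integrable lborel (\<lambda>x. (L * K) * norm (indicator {a..b} x *\<^sub>R f x))"
      by (intro integrable_mult_right integrable_norm int)
    show "AE x in lborel. norm (indicator {a..b} x *\<^sub>R prod (p x) (f x)) \<le> norm ((L * K) * norm (indicator {a..b} x *\<^sub>R f x))"
    proof (rule AE_I2)
      fix x
      show "norm (indicator {a..b} x *\<^sub>R prod (p x) (f x)) \<le> norm ((L * K) * norm (indicator {a..b} x *\<^sub>R f x))"
      proof (cases "x \<in> {a..b}")
        case True
        have "norm (prod (p x) (f x)) \<le> norm (p x) * norm (f x) * K" by (rule K)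
        also have "\<dots> \<le> L * norm (f x) * K"
          using L(2)[OF True] K(1) by (intro mult_right_mono) auto
        finally show ?thesis using True K L by (simp add: mult_ac abs_mult)
      qed auto
    qed
  qed simp
qed

text \<open>
  The function \<open>f\<close> is locally absolutely continuous and \<open>g\<close> represents its derivative. In contrast to
  differentiability almost everywhere, this determines \<open>f\<close> up to a constant.
\<close>

definition ac_deriv :: "(real \<Rightarrow> 'a::euclidean_space) \<Rightarrow> (real \<Rightarrow> 'a) \<Rightarrow> bool" where
  "ac_deriv f g \<longleftrightarrow>
     locally_integrable g \<and> (\<forall>x y. x \<le> y \<longrightarrow> f y - f x = (LINT t:{x..y}|lborel. g t))"

lemma ac_deriv_integrable:
  "ac_deriv f g \<Longrightarrow> set_integrable lborel {x..y} g"
  by (simp add: ac_deriv_def locally_integrable_def)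

lemma ac_deriv_integral:
  "ac_deriv f g \<Longrightarrow> x \<le> y \<Longrightarrow> (LINT t:{x..y}|lborel. g t) = f y - f x"
  by (simp add: ac_deriv_def)

lemma ac_deriv_C1:
  fixes f :: "real \<Rightarrow> 'a::euclidean_space"
  assumes "\<And>x. (f has_vector_derivative g x) (at x)" "continuous_on UNIV g"
  shows "ac_deriv f g"
  unfolding ac_deriv_def
proof (intro conjI allI impI)
  show "locally_integrable g" by (rule locally_integrable_continuous) fact
  fix x y :: real assume "x \<le> y"
  then show "f y - f x = (LINT t:{x..y}|lborel. g t)"
    unfolding set_lebesgue_integral_def
    using assms by (subst integral_FTC_atLeastAtMost)
      (auto intro: has_vector_derivative_at_within continuous_on_subset)
qed

lemma ac_deriv_integral_left:
  fixes f :: "real \<Rightarrow> 'a::euclidean_space"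
  assumes "ac_deriv f g" "x \<le> y"
  shows "f y = f x + integral {x..y} g"
  using ac_deriv_integral[OF assms] set_borel_integral_eq_integral(2)[OF ac_deriv_integrable[OF assms(1)], of x y]
  by (simp add: algebra_simps)

lemma ac_deriv_continuous:
  fixes f :: "real \<Rightarrow> 'a::euclidean_space"
  assumes "ac_deriv f g"
  shows "continuous_on UNIV f"
proof -
  have "continuous (at x) f" for x
  proof -
    have "continuous_on {x - 1..x + 1} (\<lambda>u. f (x - 1) + integral {x - 1..u} g)"
      by (intro continuous_intros indefinite_integral_continuous_1
          set_borel_integral_eq_integral(1) ac_deriv_integrable[OF assms])
    then have "continuous_on {x - 1..x + 1} f"
      by (rule continuous_on_eq) (auto intro: ac_deriv_integral_left[OF assms, symmetric])
    then have "continuous_on {x - 1<..<x + 1} f"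
      by (rule continuous_on_subset) auto
    then show ?thesis
      by (subst (asm) continuous_on_eq_continuous_at) auto
  qed
  then show ?thesis by (simp add: continuous_on_eq_continuous_at)
qed

lemma ac_deriv_has_vector_derivative:
  fixes f :: "real \<Rightarrow> 'a::euclidean_space"
  assumes "ac_deriv f g" "continuous_on UNIV g"
  shows "(f has_vector_derivative g x) (at x)"
proof -
  have "((\<lambda>u. f (x - 1) + integral {x - 1..u} g) has_vector_derivative 0 + g x) (at x within {x - 1..x + 1})"
    by (intro derivative_intros integral_has_vector_derivative continuous_on_subset[OF assms(2)]) auto
  then have "(f has_vector_derivative g x) (at x within {x - 1..x + 1})"
    by (intro has_vector_derivative_transform[of x "{x - 1..x + 1}" f])
       (auto intro: ac_deriv_integral_left[OF assms(1)])
  then have "(f has_vector_derivative g x) (at x within {x - 1<..<x + 1})"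
    by (rule has_vector_derivative_within_subset) auto
  then show ?thesis
    by (subst (asm) at_within_open) auto
qed

lemma ac_deriv_add:
  "ac_deriv f f' \<Longrightarrow> ac_deriv g g' \<Longrightarrow> ac_deriv (\<lambda>x. f x + g x) (\<lambda>x. f' x + g' x)"
  unfolding ac_deriv_def
  by (auto simp: locally_integrable_add set_integral_add algebra_simps locally_integrable_def)

text \<open>
  As \<open>g\<close> is only integrable, the product need not be differentiable everywhere, and the rule is
  proved in integrated form. On \<open>{x..y}\<close>, write \<open>f s - f x\<close> as the integral of \<open>g\<close> up to \<open>s\<close>, and
  exchange the order of integration over the triangle \<open>x \<le> r \<le> s \<le> y\<close>; the inner integral of \<open>p'\<close>
  then is \<open>p y - p r\<close>.
\<close>

lemma ac_deriv_prod:
  fixes p :: "real \<Rightarrow> 'b::euclidean_space" and f :: "real \<Rightarrow> 'a::euclidean_space"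
    and prod :: "'b \<Rightarrow> 'a \<Rightarrow> 'c::euclidean_space"
  assumes prod: "bounded_bilinear prod"
    and p: "\<And>x. (p has_vector_derivative p' x) (at x)" and p': "continuous_on UNIV p'"
    and f: "ac_deriv f g"
  shows "ac_deriv (\<lambda>x. prod (p x) (f x)) (\<lambda>x. prod (p' x) (f x) + prod (p x) (g x))"
proof -
  interpret bounded_bilinear prod by fact
  have contp: "continuous_on UNIV p"
    using p by (auto simp: continuous_on_eq_continuous_at intro: has_vector_derivative_continuous)
  have contf: "continuous_on UNIV f" using f by (rule ac_deriv_continuous)
  have g: "locally_integrable g" using f by (simp add: ac_deriv_def)
  have li: "locally_integrable (\<lambda>x. prod (p' x) (f x))" "locally_integrable (\<lambda>x. prod (p x) (g x))"
    by (intro locally_integrable_prod[OF prod] p' contp g locally_integrable_continuous contf)+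
  show ?thesis
    unfolding ac_deriv_def
  proof (intro conjI allI impI)
    show "locally_integrable (\<lambda>x. prod (p' x) (f x) + prod (p x) (g x))"
      by (intro locally_integrable_add li)
    fix x y :: real assume xy: "x \<le> y"
    define q where "q = (\<lambda>s. indicator {x..y} s *\<^sub>R p' s)"
    define h where "h = (\<lambda>r. indicator {x..y} r *\<^sub>R g r)"
    have q: "integrable lborel q" unfolding q_def
      using locally_integrable_continuous[OF p'] by (simp add: locally_integrable_def set_integrable_def)
    have h: "integrable lborel h" unfolding h_def
      using g by (simp add: locally_integrable_def set_integrable_def)
    note [measurable] = borel_measurable_integrable[OF q] borel_measurable_integrable[OF h]
    obtain K where K: "K > 0" "\<And>u v. norm (prod u v) \<le> norm u * norm v * K"
      using pos_bounded by blast
    \<comment> \<open>the integrand on the triangle: the cut-offs to \<open>{x..y}\<close> are part of \<open>q\<close> and \<open>h\<close>\<close>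
    define \<Phi> where "\<Phi> = (\<lambda>(s, r). if r \<le> s then prod (q s) (h r) else 0)"
    have mprod: "(\<lambda>z. prod (fst z) (snd z)) \<in> borel_measurable (borel :: ('b \<times> 'a) measure)"
      by (intro borel_measurable_continuous_onI continuous_on continuous_intros)
    have "(\<lambda>z. prod (fst z) (snd z)) \<circ> (\<lambda>(s, r). (q s, h r)) \<in> borel_measurable (lborel \<Otimes>\<^sub>M lborel)"
      by (intro measurable_comp[OF _ mprod]) measurable
    then have [measurable]: "(\<lambda>(s, r). prod (q s) (h r)) \<in> borel_measurable (lborel \<Otimes>\<^sub>M lborel)"
      by (simp add: o_def split_beta)
    have [measurable]: "\<Phi> \<in> borel_measurable (lborel \<Otimes>\<^sub>M lborel)"
      unfolding \<Phi>_def by measurable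
    have int\<Phi>: "integrable (lborel \<Otimes>\<^sub>M lborel) \<Phi>"
    proof (rule integrableI_bounded)
      have "(\<integral>\<^sup>+z. ennreal (norm (\<Phi> z)) \<partial>(lborel \<Otimes>\<^sub>M lborel))
          \<le> (\<integral>\<^sup>+z. ennreal (K * norm (q (fst z))) * ennreal (norm (h (snd z))) \<partial>(lborel \<Otimes>\<^sub>M lborel))"
      proof (intro nn_integral_mono)
        fix z
        have "norm (\<Phi> z) \<le> (K * norm (q (fst z))) * norm (h (snd z))"
          using K(2)[of "q (fst z)" "h (snd z)"] K(1) by (auto simp: \<Phi>_def split_beta mult_ac)
        then show "ennreal (norm (\<Phi> z)) \<le> ennreal (K * norm (q (fst z))) * ennreal (norm (h (snd z)))"
          using K(1) by (simp add: ennreal_mult' [symmetric] ennreal_leI)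
      qed
      also have "\<dots> = (\<integral>\<^sup>+s. (\<integral>\<^sup>+r. ennreal (K * norm (q s)) * ennreal (norm (h r)) \<partial>lborel) \<partial>lborel)"
        by (subst lborel.nn_integral_fst[symmetric]) auto
      also have "\<dots> = (\<integral>\<^sup>+s. ennreal (K * norm (q s)) \<partial>lborel) * (\<integral>\<^sup>+r. ennreal (norm (h r)) \<partial>lborel)"
        by (simp add: nn_integral_cmult nn_integral_multc)
      also have "\<dots> < \<infinity>"
      proof -
        have "integrable lborel (\<lambda>s. K * norm (q s))" using q by simp
        then have "(\<integral>\<^sup>+s. ennreal (norm (K * norm (q s))) \<partial>lborel) < \<infinity>"
          unfolding integrable_iff_bounded by blast
        moreover have "(\<integral>\<^sup>+r. ennreal (norm (h r)) \<partial>lborel) < \<infinity>"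
          using h unfolding integrable_iff_bounded by blast
        ultimately show ?thesis using K(1) by (simp add: ennreal_mult_less_top)
      qed
      finally show "(\<integral>\<^sup>+z. ennreal (norm (\<Phi> z)) \<partial>(lborel \<Otimes>\<^sub>M lborel)) < \<infinity>" .
    qed simp
    have hint: "(\<integral>r. (if r \<le> s then h r else 0) \<partial>lborel) = f s - f x" if "s \<in> {x..y}" for s
    proof -
      have "(\<lambda>r. (if r \<le> s then h r else 0)) = (\<lambda>r. indicator {x..s} r *\<^sub>R g r)"
        using that by (auto simp: h_def indicator_def fun_eq_iff)
      then show ?thesis using ac_deriv_integral[OF f, of x s] that
        by (simp add: set_lebesgue_integral_def)
    qed
    have qint: "(\<integral>s. (if r \<le> s then q s else 0) \<partial>lborel) = p y - p r" if "r \<in> {x..y}" for r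
    proof -
      have "(\<lambda>s. (if r \<le> s then q s else 0)) = (\<lambda>s. indicator {r..y} s *\<^sub>R p' s)"
        using that by (auto simp: q_def indicator_def fun_eq_iff)
      then show ?thesis using ac_deriv_integral[OF ac_deriv_C1[OF p p'], of r y] that
        by (simp add: set_lebesgue_integral_def)
    qed
    have "(\<integral>s. (\<integral>r. \<Phi> (s, r) \<partial>lborel) \<partial>lborel) = (\<integral>s. prod (q s) (f s - f x) \<partial>lborel)"
    proof (rule Bochner_Integration.integral_cong)
      fix s
      have "(\<integral>r. \<Phi> (s, r) \<partial>lborel) = (\<integral>r. prod (q s) (if r \<le> s then h r else 0) \<partial>lborel)"
        by (intro Bochner_Integration.integral_cong) (auto simp: \<Phi>_def zero_right)
      also have "\<dots> = prod (q s) (\<integral>r. (if r \<le> s then h r else 0) \<partial>lborel)"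
        by (intro integral_bounded_linear bounded_linear_right)
           (rule Bochner_Integration.integrable_bound[OF h], auto)
      also have "\<dots> = prod (q s) (f s - f x)"
        using hint[of s] by (cases "s \<in> {x..y}") (auto simp: q_def zero_left)
      finally show "(\<integral>r. \<Phi> (s, r) \<partial>lborel) = prod (q s) (f s - f x)" .
    qed simp
    moreover have "(\<integral>r. (\<integral>s. \<Phi> (s, r) \<partial>lborel) \<partial>lborel) = (\<integral>r. prod (p y - p r) (h r) \<partial>lborel)"
    proof (rule Bochner_Integration.integral_cong)
      fix r
      have "(\<integral>s. \<Phi> (s, r) \<partial>lborel) = (\<integral>s. prod (if r \<le> s then q s else 0) (h r) \<partial>lborel)"
        by (intro Bochner_Integration.integral_cong) (auto simp: \<Phi>_def zero_left)
      also have "\<dots> = prod (\<integral>s. (if r \<le> s then q s else 0) \<partial>lborel) (h r)"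
        by (intro integral_bounded_linear bounded_linear_left)
           (rule Bochner_Integration.integrable_bound[OF q], auto)
      also have "\<dots> = prod (p y - p r) (h r)"
        using qint[of r] by (cases "r \<in> {x..y}") (auto simp: h_def zero_right)
      finally show "(\<integral>s. \<Phi> (s, r) \<partial>lborel) = prod (p y - p r) (h r)" .
    qed simp
    ultimately have eq: "(\<integral>s. prod (q s) (f s - f x) \<partial>lborel) = (\<integral>r. prod (p y - p r) (h r) \<partial>lborel)"
      using lborel_pair.Fubini_integral[of "\<lambda>s r. \<Phi> (s, r)"] int\<Phi> by simp
    have i1: "integrable lborel (\<lambda>s. prod (q s) (f s))"
      using li(1) by (simp add: locally_integrable_def set_integrable_def q_def scaleR_left)
    have i2: "integrable lborel (\<lambda>s. prod (p s) (h s))"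
      using li(2) by (simp add: locally_integrable_def set_integrable_def h_def scaleR_right)
    have i3: "integrable lborel (\<lambda>s. prod (q s) (f x))" "integrable lborel (\<lambda>s. prod (p y) (h s))"
      by (intro integrable_bounded_linear[OF bounded_linear_left] integrable_bounded_linear[OF bounded_linear_right] q h)+
    have Q: "(\<integral>s. q s \<partial>lborel) = p y - p x"
      using ac_deriv_integral[OF ac_deriv_C1[OF p p'], of x y] xy
      by (simp add: q_def set_lebesgue_integral_def)
    have H: "(\<integral>s. h s \<partial>lborel) = f y - f x"
      using ac_deriv_integral[OF f, of x y] xy by (simp add: h_def set_lebesgue_integral_def)
    have "(\<integral>s. prod (q s) (f s) \<partial>lborel) - prod (p y - p x) (f x)
        = prod (p y) (f y - f x) - (\<integral>s. prod (p s) (h s) \<partial>lborel)"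
      using eq i1 i2 i3 q h
      by (simp add: diff_right diff_left integral_bounded_linear[OF bounded_linear_left]
          integral_bounded_linear[OF bounded_linear_right] flip: Q H)
    then have "(\<integral>s. prod (q s) (f s) + prod (p s) (h s) \<partial>lborel) = prod (p y) (f y) - prod (p x) (f x)"
      using i1 i2 by (simp add: diff_left diff_right algebra_simps)
    then show "prod (p y) (f y) - prod (p x) (f x) =
        (LINT t:{x..y}|lborel. prod (p' t) (f t) + prod (p t) (g t))"
      by (simp add: set_lebesgue_integral_def q_def h_def scaleR_left scaleR_right scaleR_add_right)
  qed
qed

section \<open>Test functions\<close>

lemma smooth_differentiable: "smooth f \<Longrightarrow> f differentiable (at x)"
  unfolding smooth_def by (drule spec[of _ 0]) simp

lemma smooth_has_vector_derivative:
  "smooth f \<Longrightarrow> (f has_vector_derivative dx f x) (at x)"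
  unfolding dx_def by (simp add: smooth_differentiable flip: vector_derivative_works)

lemma dx_eqI:
  fixes f :: "real \<Rightarrow> 'a::euclidean_space"
  shows "(\<And>x. (f has_vector_derivative g x) (at x)) \<Longrightarrow> dx f = g"
  unfolding dx_def by (intro ext vector_derivative_at)

lemma smooth_dx: "smooth f \<Longrightarrow> smooth (dx f)"
  unfolding smooth_def
proof (intro allI)
  fix n x assume "\<forall>n x. (dx ^^ n) f differentiable at x"
  then have "(dx ^^ Suc n) f differentiable at x" by blast
  then show "(dx ^^ n) (dx f) differentiable at x" by (simp only: funpow_Suc_right comp_apply)
qed

lemma smooth_coinduct:
  assumes "f \<in> S" and step: "\<And>f. f \<in> S \<Longrightarrow> (\<forall>x. f differentiable (at x)) \<and> dx f \<in> S"
  shows "smooth f"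
proof -
  have "(dx ^^ n) f \<in> S" for n
    by (induction n) (use assms in auto)
  then show ?thesis unfolding smooth_def using step by blast
qed

lemma smooth_continuous: "smooth f \<Longrightarrow> continuous_on UNIV f"
  by (auto simp: continuous_on_eq_continuous_at smooth_differentiable differentiable_imp_continuous_within)

text \<open>
  Derivatives of a product are sums of products. Closing the smooth functions under both operations
  makes the induction behind \<open>smooth_coinduct\<close> go through without a Leibniz formula.
\<close>

inductive_set smooth_algebra :: "(real \<Rightarrow> real) set" where
  base: "smooth f \<Longrightarrow> f \<in> smooth_algebra"
| add: "f \<in> smooth_algebra \<Longrightarrow> g \<in> smooth_algebra \<Longrightarrow> (\<lambda>x. f x + g x) \<in> smooth_algebra"
| mult: "f \<in> smooth_algebra \<Longrightarrow> g \<in> smooth_algebra \<Longrightarrow> (\<lambda>x. f x * g x) \<in> smooth_algebra"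

lemma smooth_algebra_smooth:
  assumes "f \<in> smooth_algebra"
  shows "smooth f"
  using assms
proof (rule smooth_coinduct)
  fix f assume "f \<in> smooth_algebra"
  then show "(\<forall>x. f differentiable (at x)) \<and> dx f \<in> smooth_algebra"
  proof induction
    case (base f)
    then show ?case
      by (simp add: smooth_differentiable smooth_algebra.base smooth_dx)
  next
    case (add f g)
    then have d: "(f has_vector_derivative dx f x) (at x)" "(g has_vector_derivative dx g x) (at x)" for x
      unfolding dx_def by (intro vector_derivative_works[THEN iffD1]; blast)+
    have "dx (\<lambda>x. f x + g x) = (\<lambda>x. dx f x + dx g x)"
      by (rule dx_eqI) (rule has_vector_derivative_add[OF d])
    moreover have "(\<lambda>x. f x + g x) differentiable (at x)" for x
      by (rule differentiableI_vector[OF has_vector_derivative_add[OF d]])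
    ultimately show ?case using add by (simp add: smooth_algebra.add)
  next
    case (mult f g)
    then have d: "(f has_vector_derivative dx f x) (at x)" "(g has_vector_derivative dx g x) (at x)" for x
      unfolding dx_def by (intro vector_derivative_works[THEN iffD1]; blast)+
    have "dx (\<lambda>x. f x * g x) = (\<lambda>x. f x * dx g x + dx f x * g x)"
      by (rule dx_eqI) (rule has_vector_derivative_mult[OF d])
    moreover have "(\<lambda>x. f x * g x) differentiable (at x)" for x
      by (rule differentiableI_vector[OF has_vector_derivative_mult[OF d]])
    ultimately show ?case using mult by (simp add: smooth_algebra.add smooth_algebra.mult)
  qed
qed

lemma smooth_add: "smooth f \<Longrightarrow> smooth g \<Longrightarrow> smooth (\<lambda>x. f x + g x)" for f g :: "real \<Rightarrow> real"
  by (rule smooth_algebra_smooth[OF smooth_algebra.add[OF smooth_algebra.base smooth_algebra.base]])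

lemma smooth_mult: "smooth f \<Longrightarrow> smooth g \<Longrightarrow> smooth (\<lambda>x. f x * g x)" for f g :: "real \<Rightarrow> real"
  by (rule smooth_algebra_smooth[OF smooth_algebra.mult[OF smooth_algebra.base smooth_algebra.base]])

lemma smooth_const: "smooth (\<lambda>x. c)" for c :: real
proof (rule smooth_coinduct)
  show "(\<lambda>x. c) \<in> range (\<lambda>c x. c)" by blast
  fix f :: "real \<Rightarrow> real" assume "f \<in> range (\<lambda>c x. c)"
  then obtain c where f: "f = (\<lambda>x. c)" by blast
  have "dx f = (\<lambda>x. 0)" unfolding f by (intro dx_eqI derivative_intros)
  then show "(\<forall>x. f differentiable (at x)) \<and> dx f \<in> range (\<lambda>c x. c)"
    by (auto simp: f)
qed

lemma smooth_affine:
  fixes f :: "real \<Rightarrow> real"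
  assumes "smooth f"
  shows "smooth (\<lambda>x. f (c * x + d))"
proof (rule smooth_coinduct)
  let ?S = "{(\<lambda>x. k * g (c * x + d)) | k g. smooth g}"
  show "(\<lambda>x. f (c * x + d)) \<in> ?S"
    using assms by (intro CollectI exI[of _ 1] exI[of _ f]) simp
  fix h :: "real \<Rightarrow> real" assume "h \<in> ?S"
  then obtain k g where h: "h = (\<lambda>x. k * g (c * x + d))" and g: "smooth g" by blast
  have g': "(g has_field_derivative dx g x) (at x)" for x
    using smooth_has_vector_derivative[OF g] by (simp add: has_real_derivative_iff_has_vector_derivative)
  have d: "(h has_vector_derivative (k * c) * dx g (c * x + d)) (at x)" for x
    unfolding h has_real_derivative_iff_has_vector_derivative[symmetric]
    by (auto intro!: derivative_eq_intros DERIV_chain2[OF g'])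
  then have "dx h = (\<lambda>x. (k * c) * dx g (c * x + d))" by (rule dx_eqI)
  then show "(\<forall>x. h differentiable (at x)) \<and> dx h \<in> ?S"
    using smooth_dx[OF g] differentiableI_vector[OF d] by blast
qed

text \<open>
  All derivatives of \<open>exp (- 1 / x)\<close>, extended by zero to \<open>x \<le> 0\<close>, are of this form; so the family is
  closed under differentiation, and its members are smooth.
\<close>

definition flat_poly :: "real poly \<Rightarrow> real \<Rightarrow> real" where
  "flat_poly p x = (if x > 0 then poly p (1 / x) * exp (- (1 / x)) else 0)"

lemma poly_div_exp_tendsto_0: "((\<lambda>y. poly p y * exp (- y)) \<longlongrightarrow> 0) at_top" for p :: "real poly"
proof -
  have "((\<lambda>y. \<Sum>i\<le>degree p. coeff p i * (y ^ i / exp y)) \<longlongrightarrow> (\<Sum>i\<le>degree p. coeff p i * 0)) at_top"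
    by (intro tendsto_intros tendsto_power_div_exp_0)
  moreover have "(\<Sum>i\<le>degree p. coeff p i * (y ^ i / exp y)) = poly p y * exp (- y)" for y
    by (simp add: poly_altdef exp_minus sum_distrib_right divide_inverse mult.assoc)
  ultimately show ?thesis by simp
qed

lemma flat_poly_derivative:
  "(flat_poly p has_real_derivative flat_poly (monom 1 2 * (p - pderiv p)) x) (at x)"
proof -
  consider "x > 0" | "x < 0" | "x = 0" by linarith
  then show ?thesis
  proof cases
    case 1
    have "((\<lambda>x. poly p (1 / x) * exp (- (1 / x))) has_real_derivative
        flat_poly (monom 1 2 * (p - pderiv p)) x) (at x)"
      using 1 by (auto intro!: derivative_eq_intros DERIV_chain2[OF poly_DERIV]
          simp: flat_poly_def poly_monom field_simps power2_eq_square)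
    then show ?thesis
      by (rule has_field_derivative_transform_within_open[of _ _ _ "{0<..}"])
         (use 1 in \<open>auto simp: flat_poly_def\<close>)
  next
    case 2
    have "((\<lambda>x. 0) has_real_derivative 0) (at x)" by simp
    then have "(flat_poly p has_real_derivative 0) (at x)"
      by (rule has_field_derivative_transform_within_open[of _ _ _ "{..<0}"])
         (use 2 in \<open>auto simp: flat_poly_def\<close>)
    then show ?thesis using 2 by (simp add: flat_poly_def)
  next
    case 3
    \<comment> \<open>at the gluing point, \<open>y = 1 / h\<close> turns the difference quotient into \<open>y * poly p y * exp (- y)\<close>\<close>
    have "((\<lambda>h. flat_poly p h / h) \<longlongrightarrow> 0) (at_left 0)"
      by (rule tendsto_eventually)
         (auto simp: eventually_at_filter flat_poly_def)
    moreover have "((\<lambda>h. flat_poly p h / h) \<longlongrightarrow> 0) (at_right 0)"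
    proof (rule Lim_transform_eventually)
      have "((\<lambda>h. poly (pCons 0 p) (inverse h) * exp (- inverse h)) \<longlongrightarrow> 0) (at_right 0)"
        by (rule filterlim_compose[OF poly_div_exp_tendsto_0 filterlim_inverse_at_top_right])
      then show "((\<lambda>h. poly (pCons 0 p) (inverse h) * exp (- inverse h)) \<longlongrightarrow> 0) (at_right 0)" .
      show "\<forall>\<^sub>F h in at_right 0. poly (pCons 0 p) (inverse h) * exp (- inverse h) = flat_poly p h / h"
        by (auto simp: eventually_at_filter flat_poly_def field_simps)
    qed
    ultimately have "((\<lambda>h. flat_poly p h / h) \<longlongrightarrow> 0) (at 0)"
      using filterlim_split_at by blast
    then show ?thesis using 3
      by (simp add: has_field_derivative_iff flat_poly_def)
  qed
qed

lemma smooth_flat_poly: "smooth (flat_poly p)"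
proof (rule smooth_coinduct)
  show "flat_poly p \<in> range flat_poly" by blast
  fix f assume "f \<in> range flat_poly"
  then obtain p where f: "f = flat_poly p" by blast
  have d: "(f has_vector_derivative flat_poly (monom 1 2 * (p - pderiv p)) x) (at x)" for x
    unfolding f has_real_derivative_iff_has_vector_derivative[symmetric] by (rule flat_poly_derivative)
  then have "dx f = flat_poly (monom 1 2 * (p - pderiv p))" by (rule dx_eqI)
  then show "(\<forall>x. f differentiable (at x)) \<and> dx f \<in> range flat_poly"
    using d by (auto intro: differentiableI_vector)
qed

text \<open>
  Since \<open>exp (- 1 / (n c))\<close> tends to \<open>1\<close> for every \<open>c > 0\<close>, stretching the two one-sided cut-offs
  makes these functions converge to the indicator of \<open>{p<..<q}\<close>, with supports in \<open>{p..q}\<close>.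
\<close>

definition bump :: "real \<Rightarrow> real \<Rightarrow> nat \<Rightarrow> real \<Rightarrow> real" where
  "bump p q n x = flat_poly 1 (real n * (x - p)) * flat_poly 1 (real n * (q - x))"

lemma bump_nonneg: "0 \<le> bump p q n x"
  by (simp add: bump_def flat_poly_def)

lemma bump_le_indicator: "bump p q n x \<le> indicator {p..q} x"
  unfolding bump_def flat_poly_def
  by (auto simp: indicator_def zero_less_mult_iff intro!: mult_le_one)

lemma bump_support: "bump p q n x \<noteq> 0 \<Longrightarrow> x \<in> {p..q}"
  using bump_nonneg[of p q n x] bump_le_indicator[of p q n x] by (cases "x \<in> {p..q}") simp_all

lemma test_function_bump: "test_function (bump p q n)"
  unfolding test_function_def
proof
  have "bump p q n = (\<lambda>x. flat_poly 1 (real n * x + (- real n * p)) * flat_poly 1 (- real n * x + real n * q))"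
    by (simp add: bump_def fun_eq_iff algebra_simps)
  then show "smooth (bump p q n)"
    by (simp only:) (intro smooth_mult smooth_affine smooth_flat_poly)
  show "bounded {x. bump p q n x \<noteq> 0}"
    by (rule bounded_subset[OF bounded_closed_interval[of p q]]) (use bump_support in auto)
qed

lemma flat_poly_1_tendsto:
  assumes "c > 0"
  shows "(\<lambda>n. flat_poly 1 (real n * c)) \<longlonglongrightarrow> 1"
proof (rule Lim_transform_eventually)
  have "(\<lambda>n. exp (- (inverse (real n) * inverse c))) \<longlonglongrightarrow> exp (- (0 * inverse c))"
    by (intro tendsto_intros lim_inverse_n)
  then show "(\<lambda>n. exp (- (inverse (real n) * inverse c))) \<longlonglongrightarrow> 1" by simp
  show "\<forall>\<^sub>F n in sequentially. exp (- (inverse (real n) * inverse c)) = flat_poly 1 (real n * c)"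
    using eventually_gt_at_top[of 0]
    by eventually_elim (use assms in \<open>simp add: flat_poly_def field_simps\<close>)
qed

lemma bump_tendsto:
  assumes "p < q"
  shows "(\<lambda>n. bump p q n x) \<longlonglongrightarrow> indicator {p<..<q} x"
proof (cases "x \<in> {p<..<q}")
  case True
  then have "(\<lambda>n. bump p q n x) \<longlonglongrightarrow> 1 * 1"
    unfolding bump_def by (intro tendsto_mult flat_poly_1_tendsto) auto
  then show ?thesis using True by simp
next
  case False
  then have "bump p q n x = 0" for n
    unfolding bump_def flat_poly_def by (auto simp: zero_less_mult_iff)
  then show ?thesis using False by simp
qed

lemma test_function_support:
  assumes "test_function \<eta>"
  obtains N where "N > 0" "\<And>x. \<bar>x\<bar> \<ge> N \<Longrightarrow> \<eta> x = 0"
proof -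
  obtain B where "B > 0" "\<And>x. \<eta> x \<noteq> 0 \<Longrightarrow> \<bar>x\<bar> \<le> B"
    using assms unfolding test_function_def bounded_pos by auto
  then show thesis by (intro that[of "B + 1"]) force+
qed

lemma test_functionI:
  assumes "smooth \<eta>" "\<And>x. \<bar>x\<bar> > N \<Longrightarrow> \<eta> x = 0"
  shows "test_function \<eta>"
proof -
  have "{x. \<eta> x \<noteq> 0} \<subseteq> {-N..N}"
  proof
    fix x assume "x \<in> {x. \<eta> x \<noteq> 0}"
    then have "\<bar>x\<bar> \<le> N" using assms(2)[of x] by (cases "\<bar>x\<bar> > N") auto
    then show "x \<in> {-N..N}" by auto
  qed
  then show ?thesis using assms(1) bounded_subset[OF bounded_closed_interval]
    by (auto simp: test_function_def)
qed

lemma test_function_dx: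
  assumes "test_function \<eta>"
  shows "test_function (dx \<eta>)"
proof -
  obtain N where N: "\<And>x. \<bar>x\<bar> \<ge> N \<Longrightarrow> \<eta> x = 0"
    using test_function_support[OF assms] by blast
  show ?thesis
  proof (rule test_functionI)
    show "smooth (dx \<eta>)" using assms by (simp add: test_function_def smooth_dx)
    fix x :: real assume x: "\<bar>x\<bar> > N"
    have "((\<lambda>x. 0) has_vector_derivative (0::real)) (at x)" by simp
    moreover have "open {x :: real. \<bar>x\<bar> > N}"
      by (intro open_Collect_less continuous_intros)
    ultimately have "(\<eta> has_vector_derivative 0) (at x)"
      by (rule has_vector_derivative_transform_within_open) (use x N in \<open>auto simp: less_imp_le\<close>)
    then show "dx \<eta> x = 0" unfolding dx_def by (rule vector_derivative_at)
  qed
qed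

lemma test_function_diff_scale:
  assumes "test_function \<eta>" "test_function \<zeta>"
  shows "test_function (\<lambda>x. \<eta> x - c * \<zeta> x)"
proof -
  obtain M N where MN: "\<And>x. \<bar>x\<bar> \<ge> M \<Longrightarrow> \<eta> x = 0" "\<And>x. \<bar>x\<bar> \<ge> N \<Longrightarrow> \<zeta> x = 0"
    using test_function_support[OF assms(1)] test_function_support[OF assms(2)] by metis
  have "smooth (\<lambda>x. \<eta> x + (- c) * \<zeta> x)"
    using assms by (intro smooth_add smooth_mult smooth_const) (auto simp: test_function_def)
  then show ?thesis
    by (intro test_functionI[of _ "max M N"]) (auto simp: MN)
qed

lemma test_function_continuous: "test_function \<eta> \<Longrightarrow> continuous_on UNIV \<eta>"
  by (simp add: test_function_def smooth_continuous)

lemma test_function_locally_integrable: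
  fixes f :: "real \<Rightarrow> 'a::euclidean_space"
  assumes "test_function \<eta>" "locally_integrable f"
  shows "locally_integrable (\<lambda>x. \<eta> x *\<^sub>R f x)"
  by (rule locally_integrable_prod[OF bounded_bilinear_scaleR test_function_continuous]) fact+

lemma test_function_integrable:
  fixes f :: "real \<Rightarrow> 'a::euclidean_space"
  assumes \<eta>: "test_function \<eta>" and f: "locally_integrable f"
  shows "integrable lborel (\<lambda>x. \<eta> x *\<^sub>R f x)"
proof -
  obtain N where N: "\<And>x. \<bar>x\<bar> \<ge> N \<Longrightarrow> \<eta> x = 0"
    using test_function_support[OF \<eta>] by blast
  have "(\<lambda>x. \<eta> x *\<^sub>R f x) = (\<lambda>x. indicator {-N..N} x *\<^sub>R (\<eta> x *\<^sub>R f x))"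
    using N by (force simp: fun_eq_iff indicator_def)
  then show ?thesis
    using test_function_locally_integrable[OF \<eta> f]
    unfolding locally_integrable_def set_integrable_def by metis
qed

text \<open>Integrating the product rule over an interval that contains the support leaves no boundary terms.\<close>

lemma ac_deriv_weak_derivative:
  fixes f :: "real \<Rightarrow> 'a::euclidean_space"
  assumes f: "ac_deriv f g" and \<eta>: "test_function \<eta>"
  shows "(LINT x|lborel. dx \<eta> x *\<^sub>R f x) = - (LINT x|lborel. \<eta> x *\<^sub>R g x)"
proof -
  obtain M N where "\<And>x. \<bar>x\<bar> \<ge> M \<Longrightarrow> \<eta> x = 0" "\<And>x. \<bar>x\<bar> \<ge> N \<Longrightarrow> dx \<eta> x = 0" "M > 0" "N > 0"
    using test_function_support[OF \<eta>] test_function_support[OF test_function_dx[OF \<eta>]] by metis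
  then obtain N where N: "\<And>x. \<bar>x\<bar> \<ge> N \<Longrightarrow> \<eta> x = 0 \<and> dx \<eta> x = 0" "N > 0"
    by (metis max.bounded_iff less_max_iff_disj)
  have "ac_deriv (\<lambda>x. \<eta> x *\<^sub>R f x) (\<lambda>x. dx \<eta> x *\<^sub>R f x + \<eta> x *\<^sub>R g x)"
    using \<eta> by (intro ac_deriv_prod[OF bounded_bilinear_scaleR] smooth_has_vector_derivative f
        test_function_continuous test_function_dx) (simp add: test_function_def)
  from ac_deriv_integral[OF this, of "-N" N]
  have "(LINT t:{-N..N}|lborel. dx \<eta> t *\<^sub>R f t + \<eta> t *\<^sub>R g t) = 0"
    using N by simp
  also have "(LINT t:{-N..N}|lborel. dx \<eta> t *\<^sub>R f t + \<eta> t *\<^sub>R g t)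
      = (LINT t|lborel. dx \<eta> t *\<^sub>R f t + \<eta> t *\<^sub>R g t)"
    unfolding set_lebesgue_integral_def
    by (intro Bochner_Integration.integral_cong) (use N in \<open>force simp: indicator_def\<close>)+
  also have "\<dots> = (LINT x|lborel. dx \<eta> x *\<^sub>R f x) + (LINT x|lborel. \<eta> x *\<^sub>R g x)"
    using test_function_integrable[OF test_function_dx[OF \<eta>]
        locally_integrable_continuous[OF ac_deriv_continuous[OF f]]]
      test_function_integrable[OF \<eta>, of g] f by (simp add: ac_deriv_def)
  finally show ?thesis by (simp add: add_eq_0_iff2)
qed

section \<open>From weak to classical derivatives\<close>

text \<open>
  Intervals form an intersection-stable generator of the Borel sets, so on each bounded window all
  integrals over Borel sets vanish.
\<close>

lemma AE_zero_of_interval_integrals: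
  fixes f :: "real \<Rightarrow> 'a::euclidean_space"
  assumes f: "locally_integrable f"
    and zero: "\<And>a b. (LINT t:{a..b}|lborel. f t) = 0"
  shows "AE x in lborel. f x = 0"
proof -
  have "AE x in lborel. indicator {- real n..real n} x *\<^sub>R f x = 0" for n
  proof (rule sigma_finite_measure.density_zero[OF lborel.sigma_finite_measure_axioms])
    let ?f = "\<lambda>x. indicator {- real n..real n} x *\<^sub>R f x"
    show int: "integrable lborel ?f"
      using f by (simp add: locally_integrable_def set_integrable_def)
    have total: "(LINT x|lborel. ?f x) = 0"
      using zero[of "- real n" "real n"] by (simp add: set_lebesgue_integral_def)
    have si: "set_integrable lborel A ?f" if "A \<in> sets borel" for A
      unfolding set_integrable_def using integrable_mult_indicator[OF _ int, of A] that by simp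
    fix A :: "real set" assume "A \<in> sets lborel"
    then have "A \<in> sets borel" by simp
    then show "set_lebesgue_integral lborel A ?f = 0"
    proof (induction rule: borel_set_induct)
      case empty then show ?case by (simp add: set_lebesgue_integral_def)
    next
      case (interval a b)
      have "set_lebesgue_integral lborel {a..b} ?f = (LINT t:{max a (- real n)..min b (real n)}|lborel. f t)"
        unfolding set_lebesgue_integral_def
        by (intro Bochner_Integration.integral_cong) (auto simp: indicator_def)
      then show ?case using zero by simp
    next
      case (compl A)
      have "set_lebesgue_integral lborel (- A) ?f + set_lebesgue_integral lborel A ?f = (LINT x|lborel. ?f x)"
      proof -
        have "(LINT x|lborel. ?f x) = (LINT x|lborel. indicator (- A) x *\<^sub>R ?f x + indicator A x *\<^sub>R ?f x)"
          by (intro Bochner_Integration.integral_cong refl) (simp add: indicator_def)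
        also have "\<dots> = set_lebesgue_integral lborel (- A) ?f + set_lebesgue_integral lborel A ?f"
          using si[of A] si[of "- A"] compl(1) unfolding set_lebesgue_integral_def set_integrable_def
          by (intro Bochner_Integration.integral_add) auto
        finally show ?thesis by simp
      qed
      then show ?case using compl total by simp
    next
      case (union A)
      have "set_lebesgue_integral lborel (\<Union>i. A i) ?f = (\<Sum>i. set_lebesgue_integral lborel (A i) ?f)"
        using union by (intro lebesgue_integral_countable_add si) (auto simp: disjoint_family_on_def)
      then show ?case using union by simp
    qed
  qed
  then have "AE x in lborel. \<forall>n. indicator {- real n..real n} x *\<^sub>R f x = 0"
    unfolding AE_all_countable by blast
  then show ?thesis
  proof eventually_elim
    case (elim x)
    obtain n :: nat where "\<bar>x\<bar> \<le> real n" using real_arch_simple by blast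
    then have "x \<in> {- real n..real n}" by (simp add: abs_le_iff)
    then show ?case using elim[rule_format, of n] by simp
  qed
qed

text \<open>The indicator of an interval is a dominated limit of the test functions \<open>bump\<close>.\<close>

lemma AE_zero_of_test_functions:
  fixes f :: "real \<Rightarrow> 'a::euclidean_space"
  assumes f: "locally_integrable f"
    and zero: "\<And>\<eta>. test_function \<eta> \<Longrightarrow> (LINT x|lborel. \<eta> x *\<^sub>R f x) = 0"
  shows "AE x in lborel. f x = 0"
proof (rule AE_zero_of_interval_integrals[OF f])
  fix a b :: real
  have [measurable]: "f \<in> borel_measurable borel" by (rule locally_integrable_measurable[OF f])
  have [measurable]: "bump a b n \<in> borel_measurable borel" for n
    by (intro borel_measurable_continuous_onI test_function_continuous test_function_bump)
  show "(LINT t:{a..b}|lborel. f t) = 0"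
  proof (cases "a < b")
    case True
    have "(\<lambda>n. LINT x|lborel. bump a b n x *\<^sub>R f x) \<longlonglongrightarrow> (LINT x|lborel. indicator {a<..<b} x *\<^sub>R f x)"
    proof (rule integral_dominated_convergence)
      show "integrable lborel (\<lambda>x. norm (indicator {a..b} x *\<^sub>R f x))"
        using f by (intro integrable_norm) (simp add: locally_integrable_def set_integrable_def)
      show "AE x in lborel. (\<lambda>n. bump a b n x *\<^sub>R f x) \<longlonglongrightarrow> indicator {a<..<b} x *\<^sub>R f x"
        by (intro AE_I2 tendsto_scaleR bump_tendsto True tendsto_const)
      show "AE x in lborel. norm (bump a b n x *\<^sub>R f x) \<le> norm (indicator {a..b} x *\<^sub>R f x)" for n
        using bump_le_indicator[of a b n] bump_nonneg[of a b n]
        by (intro AE_I2) (auto intro!: mult_right_mono simp: abs_of_nonneg)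
    qed measurable
    then have "(LINT x|lborel. indicator {a<..<b} x *\<^sub>R f x) = 0"
      using zero[OF test_function_bump] by (simp add: LIMSEQ_const_iff)
    moreover have "(LINT x|lborel. indicator {a<..<b} x *\<^sub>R f x) = (LINT x|lborel. indicator {a..b} x *\<^sub>R f x)"
    proof (rule integral_cong_AE)
      have "AE x in lborel. x \<noteq> a" "AE x in lborel. x \<noteq> b" by (auto intro: AE_lborel_singleton)
      then show "AE x in lborel. indicat_real {a<..<b} x *\<^sub>R f x = indicat_real {a..b} x *\<^sub>R f x"
        by eventually_elim (auto simp: indicator_def)
    qed auto
    ultimately show ?thesis by (simp add: set_lebesgue_integral_def)
  next
    case False
    show ?thesis
      unfolding set_lebesgue_integral_def
    proof (rule integral_eq_zero_AE)
      have "AE x in lborel. x \<noteq> a" by (rule AE_lborel_singleton)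
      then show "AE x in lborel. indicat_real {a..b} x *\<^sub>R f x = 0"
        by eventually_elim (use False in \<open>auto simp: indicator_def\<close>)
    qed
  qed
qed

lemma test_function_antiderivative:
  assumes \<zeta>: "test_function \<zeta>" and mean: "(LINT x|lborel. \<zeta> x) = 0"
  obtains \<theta> where "test_function \<theta>" "dx \<theta> = \<zeta>"
proof -
  obtain N where N: "\<And>x. \<bar>x\<bar> \<ge> N \<Longrightarrow> \<zeta> x = 0" "N > 0"
    using test_function_support[OF \<zeta>] by metis
  have int: "integrable lborel \<zeta>"
    using test_function_integrable[OF \<zeta> locally_integrable_continuous[OF continuous_on_const[of _ "1::real"]]] by simp
  define \<theta> where "\<theta> = (\<lambda>x. LINT t:{..x}|lborel. \<zeta> t)"
  have si: "set_integrable lborel A \<zeta>" if "A \<in> sets borel" for A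
    unfolding set_integrable_def using integrable_mult_indicator[OF _ int, of A] that by simp
  have "ac_deriv \<theta> \<zeta>"
    unfolding ac_deriv_def
  proof (intro conjI allI impI)
    show "locally_integrable \<zeta>" by (intro locally_integrable_continuous test_function_continuous \<zeta>)
    fix x y :: real assume xy: "x \<le> y"
    have "\<theta> y = (LINT t:{..x}|lborel. \<zeta> t) + (LINT t:{x<..y}|lborel. \<zeta> t)"
      unfolding \<theta>_def using xy by (subst set_integral_Un[symmetric]) (auto intro!: si simp: ivl_disj_un)
    also have "(LINT t:{x<..y}|lborel. \<zeta> t) = (LINT t:{x..y}|lborel. \<zeta> t)"
      unfolding set_lebesgue_integral_def
    proof (rule integral_cong_AE)
      have "AE t in lborel. t \<noteq> x" by (rule AE_lborel_singleton)
      then show "AE t in lborel. indicat_real {x<..y} t *\<^sub>R \<zeta> t = indicat_real {x..y} t *\<^sub>R \<zeta> t"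
        by eventually_elim (auto simp: indicator_def)
    qed (use int in auto)
    finally show "\<theta> y - \<theta> x = (LINT t:{x..y}|lborel. \<zeta> t)" by (simp add: \<theta>_def)
  qed
  then have d: "(\<theta> has_vector_derivative \<zeta> x) (at x)" for x
    by (rule ac_deriv_has_vector_derivative[OF _ test_function_continuous[OF \<zeta>]])
  then have dx: "dx \<theta> = \<zeta>" by (rule dx_eqI)
  have "test_function \<theta>"
  proof (rule test_functionI)
    have "smooth \<zeta>" using \<zeta> by (simp add: test_function_def)
    show "smooth \<theta>"
    proof (rule smooth_coinduct)
      show "\<theta> \<in> insert \<theta> {f. smooth f}" by simp
      fix f assume "f \<in> insert \<theta> {f. smooth f}"
      then show "(\<forall>x. f differentiable (at x)) \<and> dx f \<in> insert \<theta> {f. smooth f}"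
        using d dx \<open>smooth \<zeta>\<close> by (auto intro: differentiableI_vector smooth_differentiable smooth_dx)
    qed
    fix x :: real assume x: "\<bar>x\<bar> > N"
    show "\<theta> x = 0"
    proof (cases "x > 0")
      case True
      have "\<theta> x = (LINT x|lborel. \<zeta> x)"
        unfolding \<theta>_def set_lebesgue_integral_def
        by (intro Bochner_Integration.integral_cong) (use x N True in \<open>auto simp: indicator_def\<close>)
      then show ?thesis using mean by simp
    next
      case False
      have "indicator {..x} t *\<^sub>R \<zeta> t = 0" for t
        using x N(1)[of t] False by (auto simp: indicator_def)
      then show ?thesis unfolding \<theta>_def set_lebesgue_integral_def
        by (intro integral_eq_zero_AE AE_I2)
    qed
  qed
  with dx show thesis by (rule that[rotated])
qed

text \<open>
  A test function is the derivative of a test function exactly if its mean vanishes. Subtracting from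
  \<open>\<eta>\<close> the multiple of a fixed \<open>\<eta>0\<close> with the same mean reduces the claim to the case of derivatives,
  and the subtracted part is accounted for by the constant \<open>c\<close>.
\<close>

lemma AE_const_of_weak_derivative_zero:
  fixes f :: "real \<Rightarrow> 'a::euclidean_space"
  assumes f: "locally_integrable f"
    and zero: "\<And>\<eta>. test_function \<eta> \<Longrightarrow> (LINT x|lborel. dx \<eta> x *\<^sub>R f x) = 0"
  obtains c where "AE x in lborel. f x = c"
proof -
  have one: "locally_integrable (\<lambda>x. 1::real)" by (intro locally_integrable_continuous continuous_intros)
  define \<eta>0 where "\<eta>0 = bump 0 1 1"
  have t0: "test_function \<eta>0" unfolding \<eta>0_def by (rule test_function_bump)
  have int: "integrable lborel \<eta>" if "test_function \<eta>" for \<eta>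
    using test_function_integrable[OF that one] by simp
  have nz: "(LINT x|lborel. \<eta>0 x) \<noteq> 0"
  proof
    assume "(LINT x|lborel. \<eta>0 x) = 0"
    then have "AE x in lborel. \<eta>0 x = 0"
      using int[OF t0] by (subst (asm) integral_nonneg_eq_0_iff_AE) (auto simp: \<eta>0_def bump_nonneg)
    then have "AE x in lborel. x \<notin> {0<..<1::real}"
      by eventually_elim (auto simp: \<eta>0_def bump_def flat_poly_def)
    then have "{0<..<1::real} \<in> null_sets lborel"
      by (subst (asm) AE_iff_null_sets[symmetric]) auto
    then have "emeasure lborel {0<..<1::real} = 0" by blast
    then show False by simp
  qed
  define I where "I = (LINT x|lborel. \<eta>0 x)"
  define c where "c = (1 / I) *\<^sub>R (LINT x|lborel. \<eta>0 x *\<^sub>R f x)"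
  have "AE x in lborel. f x - c = 0"
  proof (rule AE_zero_of_test_functions)
    have c: "locally_integrable (\<lambda>x. c)" by (intro locally_integrable_continuous continuous_intros)
    show "locally_integrable (\<lambda>x. f x - c)"
      by (intro locally_integrable_diff f c)
    fix \<eta> assume \<eta>: "test_function \<eta>"
    define J where "J = (LINT x|lborel. \<eta> x)"
    let ?\<zeta> = "\<lambda>x. \<eta> x - (J / I) * \<eta>0 x"
    have t: "test_function ?\<zeta>" by (intro test_function_diff_scale \<eta> t0)
    have "(LINT x|lborel. ?\<zeta> x) = 0"
      using int[OF \<eta>] int[OF t0] nz by (simp add: J_def I_def)
    then obtain \<theta> where \<theta>: "test_function \<theta>" "dx \<theta> = ?\<zeta>"
      using test_function_antiderivative[OF t] by blast
    have "0 = (LINT x|lborel. ?\<zeta> x *\<^sub>R f x)" using zero[OF \<theta>(1)] \<theta>(2) by simp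
    also have "\<dots> = (LINT x|lborel. \<eta> x *\<^sub>R f x - (J / I) *\<^sub>R (\<eta>0 x *\<^sub>R f x))"
      by (simp add: scaleR_diff_left)
    also have "\<dots> = (LINT x|lborel. \<eta> x *\<^sub>R f x) - (J / I) *\<^sub>R (LINT x|lborel. \<eta>0 x *\<^sub>R f x)"
      using test_function_integrable[OF \<eta> f] test_function_integrable[OF t0 f]
      by (subst Bochner_Integration.integral_diff, blast, intro integrable_scaleR_right)
        (blast, simp only: integral_scaleR_right)
    also have "(J / I) *\<^sub>R (LINT x|lborel. \<eta>0 x *\<^sub>R f x) = (LINT x|lborel. \<eta> x *\<^sub>R c)"
      using int[OF \<eta>] by (subst integral_scaleR_left) (simp_all add: c_def J_def)
    also have "(LINT x|lborel. \<eta> x *\<^sub>R f x) - (LINT x|lborel. \<eta> x *\<^sub>R c) = (LINT x|lborel. \<eta> x *\<^sub>R (f x - c))"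
      using test_function_integrable[OF \<eta> f] test_function_integrable[OF \<eta> c]
      by (simp add: scaleR_diff_right)
    finally show "(LINT x|lborel. \<eta> x *\<^sub>R (f x - c)) = 0" by simp
  qed
  then show thesis by (intro that[of c]) simp
qed

text \<open>The base point of the indefinite integral is \<open>0\<close>, whence the case distinction.\<close>

lemma ac_deriv_exists:
  fixes g :: "real \<Rightarrow> 'a::euclidean_space"
  assumes g: "locally_integrable g"
  obtains h where "ac_deriv h g"
proof -
  have si: "g integrable_on {a..b}" for a b
    using g by (intro set_borel_integral_eq_integral(1)) (simp add: locally_integrable_def)
  define h where "h = (\<lambda>x. if 0 \<le> x then integral {0..x} g else - integral {x..0} g)"
  have "ac_deriv h g"
    unfolding ac_deriv_def
  proof (intro conjI allI impI g)
    fix x y :: real assume xy: "x \<le> y"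
    have "(LINT t:{x..y}|lborel. g t) = integral {x..y} g"
      using g by (intro set_borel_integral_eq_integral(2)) (simp add: locally_integrable_def)
    also have "\<dots> = h y - h x"
    proof -
      consider "0 \<le> x" | "y < 0" | "x < 0" "0 \<le> y" by linarith
      then show ?thesis
      proof cases
        case 1
        then show ?thesis
          using Henstock_Kurzweil_Integration.integral_combine[OF 1 xy si] xy by (simp add: h_def algebra_simps)
      next
        case 2
        then show ?thesis
          using Henstock_Kurzweil_Integration.integral_combine[of x y 0 g, OF xy _ si] xy by (simp add: h_def algebra_simps)
      next
        case 3
        then show ?thesis
          using Henstock_Kurzweil_Integration.integral_combine[of x 0 y g, OF _ _ si] by (simp add: h_def algebra_simps)
      qed
    qed
    finally show "h y - h x = (LINT t:{x..y}|lborel. g t)" by simp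
  qed
  then show thesis by (rule that)
qed

text \<open>
  The difference of \<open>f\<close> and an indefinite integral of its weak derivative has weak derivative zero.
\<close>

lemma weak_derivative_imp_ac_deriv:
  fixes f g :: "real \<Rightarrow> 'a::euclidean_space"
  assumes f: "locally_integrable f" and g: "locally_integrable g"
    and weak: "\<And>\<eta>. test_function \<eta> \<Longrightarrow>
      (LINT x|lborel. dx \<eta> x *\<^sub>R f x) = - (LINT x|lborel. \<eta> x *\<^sub>R g x)"
  obtains h where "ac_deriv h g" "AE x in lborel. f x = h x"
proof -
  obtain h where h: "ac_deriv h g" using ac_deriv_exists[OF g] by blast
  have lh: "locally_integrable h"
    by (intro locally_integrable_continuous ac_deriv_continuous[OF h])
  obtain c where c: "AE x in lborel. f x - h x = c"
  proof (rule AE_const_of_weak_derivative_zero)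
    show "locally_integrable (\<lambda>x. f x - h x)" by (intro locally_integrable_diff f lh)
    fix \<eta> assume \<eta>: "test_function \<eta>"
    show "(LINT x|lborel. dx \<eta> x *\<^sub>R (f x - h x)) = 0"
      using weak[OF \<eta>] ac_deriv_weak_derivative[OF h \<eta>]
        test_function_integrable[OF test_function_dx[OF \<eta>] f]
        test_function_integrable[OF test_function_dx[OF \<eta>] lh]
      by (simp add: scaleR_diff_right)
  qed
  show thesis
  proof (rule that)
    show "ac_deriv (\<lambda>x. h x + c) g" using h by (simp add: ac_deriv_def)
    show "AE x in lborel. f x = h x + c" using c by eventually_elim (simp add: algebra_simps)
  qed
qed

section \<open>Functions with bounded derivatives\<close>

text \<open>
  One constant bounds the function and its derivatives up to order \<open>k\<close>, all of them continuous. The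
  recursion on \<open>k\<close> matches the inductions below, which differentiate once and apply the hypothesis to
  the derivative.
\<close>

primrec Ck_bound :: "nat \<Rightarrow> (real \<Rightarrow> 'a::euclidean_space) \<Rightarrow> real \<Rightarrow> bool" where
  "Ck_bound 0 f K \<longleftrightarrow> continuous_on UNIV f \<and> (\<forall>x. norm (f x) \<le> K)"
| "Ck_bound (Suc k) f K \<longleftrightarrow> (\<forall>x. norm (f x) \<le> K) \<and>
     (\<exists>g. (\<forall>x. (f has_vector_derivative g x) (at x)) \<and> Ck_bound k g K)"

lemma Ck_bound_mono: "Ck_bound k f K \<Longrightarrow> K \<le> L \<Longrightarrow> Ck_bound k f L"
proof (induction k arbitrary: f)
  case 0 then show ?case by (auto intro: order_trans)
next
  case (Suc k) then show ?case by (auto intro: order_trans)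
qed

lemma Ck_bound_SucI:
  assumes "\<And>x. norm (f x) \<le> K" "\<And>x. (f has_vector_derivative g x) (at x)" "Ck_bound k g L" "L \<le> K"
  shows "Ck_bound (Suc k) f K"
  using assms by (auto intro: Ck_bound_mono)

lemma Ck_bound_norm: "Ck_bound k f K \<Longrightarrow> norm (f x) \<le> K"
  by (cases k) auto

lemma Ck_bound_nonneg: "Ck_bound k f K \<Longrightarrow> 0 \<le> K"
  using Ck_bound_norm[of k f K 0] norm_ge_zero order_trans by blast

lemma has_vector_derivative_continuous_on:
  assumes "\<And>x. (f has_vector_derivative g x) (at x)"
  shows "continuous_on UNIV f"
  using assms by (auto simp: continuous_on_eq_continuous_at intro: has_vector_derivative_continuous)

lemma Ck_bound_continuous: "Ck_bound k f K \<Longrightarrow> continuous_on UNIV f"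
  by (cases k) (auto intro: has_vector_derivative_continuous_on)

lemma Ck_bound_Suc_imp: "Ck_bound (Suc k) f K \<Longrightarrow> Ck_bound k f K"
proof (induction k arbitrary: f)
  case 0 then show ?case using Ck_bound_continuous[OF 0] by auto
next
  case (Suc k)
  then obtain g where "\<forall>x. (f has_vector_derivative g x) (at x)" "Ck_bound (Suc k) g K" by auto
  then show ?case using Suc by auto
qed

lemma Ck_bound_const: "Ck_bound k (\<lambda>x. c) (norm c)"
proof -
  have z: "Ck_bound k (\<lambda>x. 0 :: 'a) K" if "0 \<le> K" for k K
    using that by (induction k) (auto intro!: exI[of _ "\<lambda>x. 0"])
  then show ?thesis by (cases k) (auto intro!: exI[of _ "\<lambda>x. 0"])
qed

lemma Ck_bound_add:
  "Ck_bound k f K \<Longrightarrow> Ck_bound k g L \<Longrightarrow> Ck_bound k (\<lambda>x. f x + g x) (K + L)"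
proof (induction k arbitrary: f g)
  case 0 then show ?case by (auto intro!: continuous_intros norm_triangle_mono)
next
  case (Suc k)
  then obtain f' g' where "\<And>x. (f has_vector_derivative f' x) (at x)" "Ck_bound k f' K"
    "\<And>x. (g has_vector_derivative g' x) (at x)" "Ck_bound k g' L" by auto
  then show ?case using Suc
    by (auto intro!: norm_triangle_mono exI[of _ "\<lambda>x. f' x + g' x"] has_vector_derivative_add)
qed

lemma Ck_bound_minus: "Ck_bound k f K \<Longrightarrow> Ck_bound k (\<lambda>x. - f x) K"
proof (induction k arbitrary: f)
  case 0 then show ?case by (auto intro!: continuous_intros)
next
  case (Suc k)
  then obtain f' where "\<And>x. (f has_vector_derivative f' x) (at x)" "Ck_bound k f' K" by auto
  then show ?case using Suc
    by (auto intro!: exI[of _ "\<lambda>x. - f' x"] has_vector_derivative_minus)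
qed

lemma Ck_bound_scaleR:
  fixes f :: "real \<Rightarrow> 'a::euclidean_space" and p :: "real \<Rightarrow> real"
  shows "Ck_bound k p K \<Longrightarrow> Ck_bound k f L \<Longrightarrow> Ck_bound k (\<lambda>x. p x *\<^sub>R f x) (2 ^ k * (K * L))"
proof (induction k arbitrary: p f)
  case 0
  then show ?case using Ck_bound_nonneg[OF 0(1)] by (auto intro!: continuous_intros mult_mono)
next
  case (Suc k)
  have KL: "0 \<le> K" "0 \<le> L" using Suc.prems Ck_bound_nonneg by blast+
  obtain p' f' where d: "\<And>x. (p has_vector_derivative p' x) (at x)" "Ck_bound k p' K"
    "\<And>x. (f has_vector_derivative f' x) (at x)" "Ck_bound k f' L" using Suc.prems by auto
  have "((\<lambda>x. p x *\<^sub>R f x) has_vector_derivative (p x *\<^sub>R f' x + p' x *\<^sub>R f x)) (at x)" for x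
    by (rule has_vector_derivative_scaleR)
       (use d in \<open>auto simp: has_real_derivative_iff_has_vector_derivative\<close>)
  moreover have "Ck_bound k (\<lambda>x. p x *\<^sub>R f' x + p' x *\<^sub>R f x) (2 ^ k * (K * L) + 2 ^ k * (K * L))"
    by (intro Ck_bound_add Suc.IH Suc.prems[THEN Ck_bound_Suc_imp] d)
  moreover have "norm (p x *\<^sub>R f x) \<le> 2 ^ Suc k * (K * L)" for x
  proof -
    have "norm (p x *\<^sub>R f x) \<le> K * L"
      using Ck_bound_norm[OF Suc.prems(1)] Ck_bound_norm[OF Suc.prems(2)] KL by (auto intro!: mult_mono)
    also have "\<dots> \<le> 2 ^ Suc k * (K * L)"
      using KL mult_right_mono[of 1 "2 ^ Suc k" "K * L"] by (simp only: one_le_power mult_nonneg_nonneg) auto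
    finally show ?thesis .
  qed
  ultimately show ?case by (intro Ck_bound_SucI) auto
qed

text \<open>
  The constant depends only on the bounds and not on the functions. This uniformity, here and below,
  is what makes the final constant independent of \<open>\<gamma>\<close>.
\<close>

lemma Ck_bound_comp:
  "\<exists>C. \<forall>(f :: real \<Rightarrow> 'a::euclidean_space) a a'.
     Ck_bound k f K \<longrightarrow> (\<forall>x. (a has_vector_derivative a' x) (at x)) \<longrightarrow> Ck_bound k a' L \<longrightarrow>
     Ck_bound k (\<lambda>x. f (a x)) C"
proof (induction k)
  case 0
  show ?case
    by (rule exI[of _ K])
      (auto intro: continuous_on_compose2[OF _ has_vector_derivative_continuous_on])
next
  case (Suc k)
  then obtain C where C: "\<And>(f :: real \<Rightarrow> 'a) a a'. Ck_bound k f K \<Longrightarrow>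
    (\<And>x. (a has_vector_derivative a' x) (at x)) \<Longrightarrow> Ck_bound k a' L \<Longrightarrow> Ck_bound k (\<lambda>x. f (a x)) C"
    by blast
  show ?case
  proof (intro exI[of _ "max K (2 ^ k * (L * C))"] allI impI)
    fix f :: "real \<Rightarrow> 'a" and a a' :: "real \<Rightarrow> real"
    assume f: "Ck_bound (Suc k) f K" and a: "\<forall>x. (a has_vector_derivative a' x) (at x)"
      and a': "Ck_bound (Suc k) a' L"
    obtain f' where f': "\<And>x. (f has_vector_derivative f' x) (at x)" "Ck_bound k f' K" using f by auto
    have "((\<lambda>x. f (a x)) has_vector_derivative a' x *\<^sub>R f' (a x)) (at x)" for x
      using vector_diff_chain_at[OF a[rule_format, of x] f'(1)] by (simp add: o_def)
    moreover have "Ck_bound k (\<lambda>x. a' x *\<^sub>R f' (a x)) (2 ^ k * (L * C))"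
      using Ck_bound_Suc_imp[OF a'] a f' by (intro Ck_bound_scaleR C) auto
    ultimately show "Ck_bound (Suc k) (\<lambda>x. f (a x)) (max K (2 ^ k * (L * C)))"
      using Ck_bound_norm[OF f] by (intro Ck_bound_SucI) (auto simp: le_max_iff_disj)
  qed
qed

lemma Ck_bound_inverse:
  assumes c: "c > 0"
  shows "\<exists>C. \<forall>p :: real \<Rightarrow> real. Ck_bound k p K \<longrightarrow> (\<forall>x. c \<le> p x) \<longrightarrow>
     Ck_bound k (\<lambda>x. inverse (p x)) C"
proof (induction k)
  case 0
  show ?case
  proof (intro exI[of _ "inverse c"] allI impI)
    fix p :: "real \<Rightarrow> real" assume p: "Ck_bound 0 p K" "\<forall>x. c \<le> p x"
    have pos: "0 < p x" for x using p(2) c by (meson less_le_trans)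
    have "inverse (p x) \<le> inverse c" for x using p(2) c by (intro le_imp_inverse_le) auto
    moreover have "continuous_on UNIV (\<lambda>x. inverse (p x))"
      using p(1) pos by (intro continuous_intros) (auto simp: less_imp_neq[THEN not_sym])
    ultimately show "Ck_bound 0 (\<lambda>x. inverse (p x)) (inverse c)"
      using pos by (auto simp: less_imp_le abs_of_pos)
  qed
next
  case (Suc k)
  then obtain C where C: "\<And>p :: real \<Rightarrow> real. Ck_bound k p K \<Longrightarrow> (\<And>x. c \<le> p x) \<Longrightarrow>
     Ck_bound k (\<lambda>x. inverse (p x)) C" by blast
  let ?D = "2 ^ k * (K * (2 ^ k * (C * C)))"
  show ?case
  proof (intro exI[of _ "max (inverse c) ?D"] allI impI)
    fix p :: "real \<Rightarrow> real" assume p: "Ck_bound (Suc k) p K" "\<forall>x. c \<le> p x"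
    have pos: "0 < p x" for x using p(2) c by (meson less_le_trans)
    obtain p' where p': "\<And>x. (p has_vector_derivative p' x) (at x)" "Ck_bound k p' K" using p(1) by auto
    have "((\<lambda>x. inverse (p x)) has_vector_derivative - (p' x *\<^sub>R (inverse (p x) *\<^sub>R inverse (p x)))) (at x)" for x
      unfolding has_real_derivative_iff_has_vector_derivative[symmetric]
      using DERIV_inverse_fun[of p "p' x" x UNIV] p'(1)[of x] pos[of x]
      by (simp add: has_real_derivative_iff_has_vector_derivative[symmetric] mult_ac)
    moreover have "Ck_bound k (\<lambda>x. - (p' x *\<^sub>R (inverse (p x) *\<^sub>R inverse (p x)))) ?D"
      using Ck_bound_Suc_imp[OF p(1)] p(2) p' by (intro Ck_bound_minus Ck_bound_scaleR C) auto
    moreover have "inverse (p x) \<le> inverse c" for x using p(2) c by (intro le_imp_inverse_le) auto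
    ultimately show "Ck_bound (Suc k) (\<lambda>x. inverse (p x)) (max (inverse c) ?D)"
      using pos by (intro Ck_bound_SucI) (auto simp: le_max_iff_disj abs_of_pos less_imp_le)
  qed
qed

text \<open>
  The identity \<open>b' = (1 / a') \<circ> b\<close> bootstraps: a bound on \<open>b'\<close> to order \<open>k\<close> controls compositions with \<open>b\<close> to
  order \<open>k\<close>, hence \<open>b'' = b' \<cdot> ((1 / a')' \<circ> b)\<close> to order \<open>k\<close>.
\<close>

lemma Ck_bound_inverse_function_deriv:
  assumes c: "c > 0"
  shows "\<exists>C. \<forall>a' b b'. Ck_bound k a' K \<longrightarrow> (\<forall>x. c \<le> a' x) \<longrightarrow>
     (\<forall>y. (b has_vector_derivative b' y) (at y)) \<longrightarrow> (\<forall>y. b' y = inverse (a' (b y))) \<longrightarrow>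
     Ck_bound k b' C"
proof (induction k)
  case 0
  obtain C where C: "\<And>p :: real \<Rightarrow> real. Ck_bound 0 p K \<Longrightarrow> (\<And>x. c \<le> p x) \<Longrightarrow>
     Ck_bound 0 (\<lambda>x. inverse (p x)) C" using Ck_bound_inverse[OF c, of 0 K] by blast
  show ?case
  proof (intro exI[of _ C] allI impI)
    fix a' b b' assume a': "Ck_bound 0 a' K" "\<forall>x. c \<le> a' x"
      and b: "\<forall>y. (b has_vector_derivative b' y) (at y)" "\<forall>y. b' y = inverse (a' (b y))"
    have q: "Ck_bound 0 (\<lambda>x. inverse (a' x)) C" using C a' by blast
    have "b' = (\<lambda>y. inverse (a' (b y)))" using b(2) by auto
    moreover have "continuous_on UNIV (\<lambda>y. inverse (a' (b y)))"
      using continuous_on_compose2[OF Ck_bound_continuous[OF q] has_vector_derivative_continuous_on] b(1) by auto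
    ultimately show "Ck_bound 0 b' C" using Ck_bound_norm[OF q] by auto
  qed
next
  case (Suc k)
  then obtain L where L: "\<And>a' b b'. Ck_bound k a' K \<Longrightarrow> (\<And>x. c \<le> a' x) \<Longrightarrow>
     (\<And>y. (b has_vector_derivative b' y) (at y)) \<Longrightarrow> (\<And>y. b' y = inverse (a' (b y))) \<Longrightarrow>
     Ck_bound k b' L" by blast
  obtain Q where Q: "\<And>p :: real \<Rightarrow> real. Ck_bound (Suc k) p K \<Longrightarrow> (\<And>x. c \<le> p x) \<Longrightarrow>
     Ck_bound (Suc k) (\<lambda>x. inverse (p x)) Q" using Ck_bound_inverse[OF c, of "Suc k" K] by blast
  obtain D where D: "\<And>(f :: real \<Rightarrow> real) a a'. Ck_bound k f Q \<Longrightarrow>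
     (\<And>x. (a has_vector_derivative a' x) (at x)) \<Longrightarrow> Ck_bound k a' L \<Longrightarrow>
     Ck_bound k (\<lambda>x. f (a x)) D" using Ck_bound_comp[of k Q L] by blast
  show ?case
  proof (intro exI[of _ "max Q (2 ^ k * (L * D))"] allI impI)
    fix a' b b' assume a': "Ck_bound (Suc k) a' K" "\<forall>x. c \<le> a' x"
      and b: "\<forall>y. (b has_vector_derivative b' y) (at y)" "\<forall>y. b' y = inverse (a' (b y))"
    have q: "Ck_bound (Suc k) (\<lambda>x. inverse (a' x)) Q" using Q a' by blast
    then obtain q' where q': "\<And>x. ((\<lambda>x. inverse (a' x)) has_vector_derivative q' x) (at x)"
      "Ck_bound k q' Q" by auto
    have b'k: "Ck_bound k b' L" using L[OF Ck_bound_Suc_imp[OF a'(1)]] a' b by blast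
    have "(b' has_vector_derivative b' y *\<^sub>R q' (b y)) (at y)" for y
    proof -
      have "b' = (\<lambda>y. inverse (a' (b y)))" using b(2) by auto
      then show ?thesis
        using vector_diff_chain_at[OF b(1)[rule_format, of y] q'(1)] by (simp add: o_def)
    qed
    moreover have "Ck_bound k (\<lambda>y. b' y *\<^sub>R q' (b y)) (2 ^ k * (L * D))"
      using b by (intro Ck_bound_scaleR b'k D[OF q'(2), of b b']) auto
    moreover have "norm (b' y) \<le> Q" for y using Ck_bound_norm[OF q] b(2) by auto
    ultimately show "Ck_bound (Suc k) b' (max Q (2 ^ k * (L * D)))"
      by (intro Ck_bound_SucI) (auto simp: le_max_iff_disj)
  qed
qed

section \<open>Changes of variables\<close>

definition line_diffeo :: "real \<Rightarrow> (real \<Rightarrow> real) \<Rightarrow> (real \<Rightarrow> real) \<Rightarrow> bool" where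
  "line_diffeo c a a' \<longleftrightarrow> c > 0 \<and> (\<forall>x. (a has_vector_derivative a' x) (at x)) \<and>
     continuous_on UNIV a' \<and> (\<forall>x. c \<le> a' x)"

text \<open>The function \<open>a t - c t\<close> is nondecreasing.\<close>

lemma line_diffeo_expanding:
  assumes "line_diffeo c a a'" "x \<le> y"
  shows "c * (y - x) \<le> a y - a x"
proof -
  have "(\<lambda>t. a t - c * t) x \<le> (\<lambda>t. a t - c * t) y"
  proof (rule DERIV_nonneg_imp_nondecreasing[OF assms(2)])
    fix t
    have "(a has_real_derivative a' t) (at t)" "c \<le> a' t"
      using assms(1) by (auto simp: line_diffeo_def has_real_derivative_iff_has_vector_derivative)
    then show "\<exists>z. ((\<lambda>t. a t - c * t) has_real_derivative z) (at t) \<and> z \<ge> 0"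
      by (intro exI[of _ "a' t - c"]) (auto intro!: derivative_eq_intros)
  qed
  then show ?thesis by (simp add: algebra_simps)
qed

lemma line_diffeo_strict_mono:
  assumes "line_diffeo c a a'"
  shows "strict_mono a"
proof (rule strict_monoI)
  fix x y :: real assume "x < y"
  moreover have "c > 0" using assms by (simp add: line_diffeo_def)
  ultimately have "0 < c * (y - x)" by simp
  then show "a x < a y" using line_diffeo_expanding[OF assms, of x y] \<open>x < y\<close> by linarith
qed

lemma line_diffeo_continuous: "line_diffeo c a a' \<Longrightarrow> continuous_on UNIV a"
  unfolding line_diffeo_def by (blast intro: has_vector_derivative_continuous_on)

lemma line_diffeo_surj:
  assumes a: "line_diffeo c a a'"
  shows "\<exists>x. a x = y"
proof -
  have c: "c > 0" using a by (simp add: line_diffeo_def)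
  \<comment> \<open>over the distance \<open>r\<close> from \<open>0\<close>, the expanding map \<open>a\<close> moves at least as far as \<open>y\<close>\<close>
  define r where "r = \<bar>y - a 0\<bar> / c"
  have r: "0 \<le> r" "c * r = \<bar>y - a 0\<bar>" using c by (auto simp: r_def)
  have "a (- r) \<le> y" "y \<le> a r"
    using line_diffeo_expanding[OF a, of 0 r] line_diffeo_expanding[OF a, of "- r" 0] r by auto
  then show ?thesis
    using IVT'[of a "- r" y r] r continuous_on_subset[OF line_diffeo_continuous[OF a]] by auto
qed

lemma line_diffeo_inverse:
  assumes a: "line_diffeo c a a'"
  obtains b where "\<And>x. b (a x) = x" "\<And>y. a (b y) = y"
    "\<And>y. (b has_vector_derivative inverse (a' (b y))) (at y)"
proof -
  have c: "c > 0" using a by (simp add: line_diffeo_def)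
  obtain b where ab: "\<And>y. a (b y) = y" using line_diffeo_surj[OF a] by metis
  have ba: "b (a x) = x" for x
    using strict_mono_eq[OF line_diffeo_strict_mono[OF a]] ab by metis
  have lip: "c * \<bar>b y - b z\<bar> \<le> \<bar>y - z\<bar>" for y z
    using line_diffeo_expanding[OF a, of "b y" "b z"] line_diffeo_expanding[OF a, of "b z" "b y"]
    by (cases "b y \<le> b z") (auto simp: ab abs_if)
  have "isCont b y" for y
    unfolding continuous_at_eps_delta
  proof (intro allI impI)
    fix e :: real assume "e > 0"
    have "dist (b z) (b y) < e" if "dist z y < c * e" for z
    proof -
      have "c * \<bar>b z - b y\<bar> < c * e" using lip[of z y] that by (simp add: dist_real_def)
      then show ?thesis using c by (simp add: dist_real_def)
    qed
    then show "\<exists>d>0. \<forall>z. dist z y < d \<longrightarrow> dist (b z) (b y) < e"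
      using c \<open>e > 0\<close> by (intro exI[of _ "c * e"]) auto
  qed
  then have "(b has_vector_derivative inverse (a' (b y))) (at y)" for y
    unfolding has_real_derivative_iff_has_vector_derivative[symmetric]
  proof (intro DERIV_inverse_function[where f = a and a = "y - 1" and b = "y + 1"])
    show "(a has_real_derivative a' (b y)) (at (b y))"
      using a by (simp add: line_diffeo_def has_real_derivative_iff_has_vector_derivative)
    have "c \<le> a' (b y)" using a by (simp add: line_diffeo_def)
    then show "a' (b y) \<noteq> 0" using c by linarith
  qed (use ab in auto)
  then show thesis using that ab ba by blast
qed

text \<open>
  The substitution rule as an identity of measures. It suffices to compare the two sides on intervals,
  where it is the fundamental theorem of calculus for \<open>a\<close>; integrals of functions with values in any
  Euclidean space are then transformed by the general theory.
\<close>

lemma distr_line_diffeo: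
  assumes a: "line_diffeo c a a'"
  shows "distr (density lborel (\<lambda>x. ennreal (a' x))) borel a = lborel"
proof (rule lborel_eqI[symmetric])
  have c: "c > 0" using a by (simp add: line_diffeo_def)
  have pos: "0 \<le> a' x" for x using a c by (auto simp: line_diffeo_def intro: order_trans[OF less_imp_le])
  obtain b where b: "\<And>x. b (a x) = x" "\<And>y. a (b y) = y" using line_diffeo_inverse[OF a] by metis
  have [measurable]: "a \<in> borel_measurable borel" "a' \<in> borel_measurable borel"
    using line_diffeo_continuous[OF a] a by (auto simp: line_diffeo_def intro: borel_measurable_continuous_onI)
  fix l u :: real assume "\<And>b. b \<in> Basis \<Longrightarrow> l \<bullet> b \<le> u \<bullet> b"
  then have lu: "l \<le> u" by simp
  have sm: "a x < a y \<longleftrightarrow> x < y" for x y using strict_mono_less[OF line_diffeo_strict_mono[OF a]] .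
  have blu: "b l \<le> b u" using lu sm[of "b u" "b l"] by (simp add: b)
  have vim: "a -` {l<..<u} = {b l<..<b u}"
    using sm[of "b l"] sm[of _ "b u"] by (auto simp: b)
  have "emeasure (distr (density lborel (\<lambda>x. ennreal (a' x))) borel a) (box l u)
      = (\<integral>\<^sup>+x. ennreal (a' x) * indicator {b l<..<b u} x \<partial>lborel)"
    by (simp add: emeasure_distr emeasure_density vim)
  also have "\<dots> = (\<integral>\<^sup>+x. ennreal (a' x) * indicator {b l..b u} x \<partial>lborel)"
  proof (rule nn_integral_cong_AE)
    have "AE x in lborel. x \<noteq> b l" "AE x in lborel. x \<noteq> b u" by (rule AE_lborel_singleton)+
    then show "AE x in lborel. ennreal (a' x) * indicator {b l<..<b u} x = ennreal (a' x) * indicator {b l..b u} x"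
      by eventually_elim (auto simp: indicator_def)
  qed
  also have "\<dots> = ennreal (a (b u) - a (b l))"
    by (rule nn_integral_FTC_Icc)
       (use a blu pos in \<open>auto simp: line_diffeo_def has_real_derivative_iff_has_vector_derivative\<close>)
  finally show "emeasure (distr (density lborel (\<lambda>x. ennreal (a' x))) borel a) (box l u) = (\<Prod>b\<in>Basis. (u - l) \<bullet> b)"
    by (simp add: b)
qed simp

context
  fixes c :: real and a a' :: "real \<Rightarrow> real"
  assumes a: "line_diffeo c a a'"
begin

lemma line_diffeo_measurable: "a \<in> borel_measurable borel" "a' \<in> borel_measurable borel"
  using line_diffeo_continuous[OF a] a by (auto simp: line_diffeo_def intro: borel_measurable_continuous_onI)

lemma line_diffeo_pos: "0 < a' x"
  using a by (auto simp: line_diffeo_def intro: less_le_trans)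

lemma line_diffeo_nn_integral:
  assumes [measurable]: "h \<in> borel_measurable borel"
  shows "(\<integral>\<^sup>+x. ennreal (a' x) * h (a x) \<partial>lborel) = (\<integral>\<^sup>+x. h x \<partial>lborel)"
proof -
  note [measurable] = line_diffeo_measurable
  have "(\<integral>\<^sup>+x. h x \<partial>lborel) = (\<integral>\<^sup>+x. h x \<partial>distr (density lborel (\<lambda>x. ennreal (a' x))) borel a)"
    by (simp add: distr_line_diffeo[OF a])
  also have "\<dots> = (\<integral>\<^sup>+x. ennreal (a' x) * h (a x) \<partial>lborel)"
    by (simp add: nn_integral_distr nn_integral_density)
  finally show ?thesis by simp
qed

lemma line_diffeo_integral:
  fixes h :: "real \<Rightarrow> 'a::euclidean_space"
  assumes [measurable]: "h \<in> borel_measurable borel"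
  shows "(LINT x|lborel. a' x *\<^sub>R h (a x)) = (LINT x|lborel. h x)"
    and "integrable lborel (\<lambda>x. a' x *\<^sub>R h (a x)) \<longleftrightarrow> integrable lborel h"
proof -
  note [measurable] = line_diffeo_measurable
  have nn: "AE x in lborel. 0 \<le> a' x" using line_diffeo_pos by (simp add: less_imp_le)
  have "(LINT x|lborel. h x) = (LINT x|distr (density lborel (\<lambda>x. ennreal (a' x))) borel a. h x)"
    by (simp add: distr_line_diffeo[OF a])
  also have "\<dots> = (LINT x|lborel. a' x *\<^sub>R h (a x))"
    using nn by (simp add: integral_distr integral_density)
  finally show "(LINT x|lborel. a' x *\<^sub>R h (a x)) = (LINT x|lborel. h x)" by simp
  have "integrable lborel h \<longleftrightarrow> integrable (distr (density lborel (\<lambda>x. ennreal (a' x))) borel a) h"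
    by (simp add: distr_line_diffeo[OF a])
  also have "\<dots> \<longleftrightarrow> integrable lborel (\<lambda>x. a' x *\<^sub>R h (a x))"
    using nn by (simp add: integrable_distr_eq integrable_density)
  finally show "integrable lborel (\<lambda>x. a' x *\<^sub>R h (a x)) \<longleftrightarrow> integrable lborel h" by simp
qed

lemma line_diffeo_AE:
  assumes "AE x in lborel. P x"
  shows "AE x in lborel. P (a x)"
proof -
  note [measurable] = line_diffeo_measurable
  have "AE x in distr (density lborel (\<lambda>x. ennreal (a' x))) borel a. P x"
    using assms by (simp only: distr_line_diffeo[OF a])
  then have "AE x in density lborel (\<lambda>x. ennreal (a' x)). P (a x)"
    by (intro AE_distrD[of a _ borel]) auto
  then show ?thesis
    using line_diffeo_pos by (subst (asm) AE_density) auto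
qed

text \<open>The chain rule is the substitution rule on the interval \<open>{x..y}\<close>, which \<open>a\<close> maps onto \<open>{a x..a y}\<close>.\<close>

lemma ac_deriv_comp:
  fixes f :: "real \<Rightarrow> 'a::euclidean_space"
  assumes f: "ac_deriv f g"
  shows "ac_deriv (\<lambda>x. f (a x)) (\<lambda>x. a' x *\<^sub>R g (a x))"
proof -
  have g: "locally_integrable g" using f by (simp add: ac_deriv_def)
  have [measurable]: "g \<in> borel_measurable borel" by (rule locally_integrable_measurable[OF g])
  have sm: "a x \<le> a y \<longleftrightarrow> x \<le> y" for x y using strict_mono_less_eq[OF line_diffeo_strict_mono[OF a]] .
  have ind: "indicator {x..y} t *\<^sub>R (a' t *\<^sub>R g (a t)) = a' t *\<^sub>R (indicator {a x..a y} (a t) *\<^sub>R g (a t))" for x y t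
    by (simp add: indicator_def sm)
  show ?thesis
    unfolding ac_deriv_def locally_integrable_def set_integrable_def set_lebesgue_integral_def ind
  proof (intro conjI allI impI)
    fix x y
    show "integrable lborel (\<lambda>t. a' t *\<^sub>R (indicator {a x..a y} (a t) *\<^sub>R g (a t)))"
      using line_diffeo_integral(2)[of "\<lambda>t. indicator {a x..a y} t *\<^sub>R g t"] g
      by (simp add: locally_integrable_def set_integrable_def)
    assume "x \<le> y"
    then show "f (a y) - f (a x) = (LINT t|lborel. a' t *\<^sub>R (indicator {a x..a y} (a t) *\<^sub>R g (a t)))"
      using line_diffeo_integral(1)[of "\<lambda>t. indicator {a x..a y} t *\<^sub>R g t"] ac_deriv_integral[OF f, of "a x" "a y"]
      by (simp add: set_lebesgue_integral_def sm)
  qed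
qed

end

section \<open>Square integrable functions\<close>

text \<open>
  An integral with values in \<open>[0, \<infinity>]\<close> makes square integrability part of the inequality.
\<close>

definition L2_bound :: "(real \<Rightarrow> 'a::euclidean_space) \<Rightarrow> real \<Rightarrow> bool" where
  "L2_bound f B \<longleftrightarrow> f \<in> borel_measurable borel \<and> 0 \<le> B \<and>
     (\<integral>\<^sup>+x. ennreal ((norm (f x))\<^sup>2) \<partial>lborel) \<le> ennreal (B\<^sup>2)"

lemma L2_bound_mono: "L2_bound f A \<Longrightarrow> A \<le> B \<Longrightarrow> L2_bound f B"
  unfolding L2_bound_def by (auto intro: order_trans[OF _ ennreal_leI] power_mono)

lemma L2_bound_dominated:
  assumes g: "L2_bound g B" and [measurable]: "f \<in> borel_measurable borel"
    and le: "\<And>x. norm (f x) \<le> K * norm (g x)" and K: "0 \<le> K"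
  shows "L2_bound f (K * B)"
  unfolding L2_bound_def
proof (intro conjI)
  have [measurable]: "g \<in> borel_measurable borel" using g by (simp add: L2_bound_def)
  have "(\<integral>\<^sup>+x. ennreal ((norm (f x))\<^sup>2) \<partial>lborel) \<le> (\<integral>\<^sup>+x. ennreal (K\<^sup>2) * ennreal ((norm (g x))\<^sup>2) \<partial>lborel)"
    using power_mono[OF le norm_ge_zero, of _ 2]
    by (intro nn_integral_mono) (simp add: ennreal_mult'[symmetric] power_mult_distrib ennreal_leI)
  also have "\<dots> = ennreal (K\<^sup>2) * (\<integral>\<^sup>+x. ennreal ((norm (g x))\<^sup>2) \<partial>lborel)"
    by (rule nn_integral_cmult) simp
  also have "\<dots> \<le> ennreal (K\<^sup>2) * ennreal (B\<^sup>2)"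
    using g by (intro mult_left_mono) (auto simp: L2_bound_def)
  also have "\<dots> = ennreal ((K * B)\<^sup>2)" by (simp add: ennreal_mult'[symmetric] power_mult_distrib)
  finally show "(\<integral>\<^sup>+x. ennreal ((norm (f x))\<^sup>2) \<partial>lborel) \<le> ennreal ((K * B)\<^sup>2)" .
qed (use g K in \<open>auto simp: L2_bound_def\<close>)

text \<open>
  The factor \<open>2\<close> comes from using \<open>(s + t)\<^sup>2 \<le> 2 s\<^sup>2 + 2 t\<^sup>2\<close> in place of Minkowski's inequality.
\<close>

lemma L2_bound_add:
  assumes f: "L2_bound f A" and g: "L2_bound g B"
  shows "L2_bound (\<lambda>x. f x + g x) (2 * (A + B))"
  unfolding L2_bound_def
proof (intro conjI)
  have [measurable]: "f \<in> borel_measurable borel" "g \<in> borel_measurable borel"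
    and AB: "0 \<le> A" "0 \<le> B" using f g by (auto simp: L2_bound_def)
  have two: "ennreal 2 * ennreal u + ennreal 2 * ennreal v = ennreal (2 * u + 2 * v)"
    if "0 \<le> u" "0 \<le> v" for u v
    using that by (simp add: ennreal_mult')
  have "(\<integral>\<^sup>+x. ennreal ((norm (f x + g x))\<^sup>2) \<partial>lborel)
      \<le> (\<integral>\<^sup>+x. ennreal 2 * ennreal ((norm (f x))\<^sup>2) + ennreal 2 * ennreal ((norm (g x))\<^sup>2) \<partial>lborel)"
  proof (rule nn_integral_mono)
    fix x
    have "(norm (f x + g x))\<^sup>2 \<le> (norm (f x) + norm (g x))\<^sup>2"
      by (intro power_mono norm_triangle_ineq norm_ge_zero)
    also have "\<dots> \<le> 2 * (norm (f x))\<^sup>2 + 2 * (norm (g x))\<^sup>2"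
      using sum_squares_ge_zero[of "norm (f x) - norm (g x)" 0] by (simp add: power2_eq_square algebra_simps)
    finally show "ennreal ((norm (f x + g x))\<^sup>2) \<le> ennreal 2 * ennreal ((norm (f x))\<^sup>2) + ennreal 2 * ennreal ((norm (g x))\<^sup>2)"
      by (subst two) (simp_all add: ennreal_leI del: ennreal_plus)
  qed
  also have "\<dots> = ennreal 2 * (\<integral>\<^sup>+x. ennreal ((norm (f x))\<^sup>2) \<partial>lborel) + ennreal 2 * (\<integral>\<^sup>+x. ennreal ((norm (g x))\<^sup>2) \<partial>lborel)"
    by (simp add: nn_integral_add nn_integral_cmult)
  also have "\<dots> \<le> ennreal 2 * ennreal (A\<^sup>2) + ennreal 2 * ennreal (B\<^sup>2)"
    using f g by (intro add_mono mult_left_mono) (auto simp: L2_bound_def)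
  also have "\<dots> = ennreal (2 * A\<^sup>2 + 2 * B\<^sup>2)"
    by (rule two) simp_all
  also have "\<dots> \<le> ennreal ((2 * (A + B))\<^sup>2)"
    using AB by (intro ennreal_leI) (simp add: power2_eq_square algebra_simps)
  finally show "(\<integral>\<^sup>+x. ennreal ((norm (f x + g x))\<^sup>2) \<partial>lborel) \<le> ennreal ((2 * (A + B))\<^sup>2)" .
qed (use f g in \<open>auto simp: L2_bound_def\<close>)

lemma L2_bound_comp:
  assumes a: "line_diffeo c a a'" and f: "L2_bound f B"
  shows "L2_bound (\<lambda>x. f (a x)) (B / sqrt c)"
  unfolding L2_bound_def
proof (intro conjI)
  have c: "c > 0" using a by (simp add: line_diffeo_def)
  note [measurable] = line_diffeo_measurable[OF a]
  have [measurable]: "f \<in> borel_measurable borel" using f by (auto simp: L2_bound_def)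
  show "(\<lambda>x. f (a x)) \<in> borel_measurable borel" by measurable
  have "(\<integral>\<^sup>+x. ennreal ((norm (f (a x)))\<^sup>2) \<partial>lborel)
      \<le> (\<integral>\<^sup>+x. ennreal (1 / c) * (ennreal (a' x) * ennreal ((norm (f (a x)))\<^sup>2)) \<partial>lborel)"
  proof (rule nn_integral_mono)
    fix x
    have "1 * (norm (f (a x)))\<^sup>2 \<le> (1 / c * a' x) * (norm (f (a x)))\<^sup>2"
      using a c by (intro mult_right_mono) (auto simp: line_diffeo_def field_simps)
    then show "ennreal ((norm (f (a x)))\<^sup>2) \<le> ennreal (1 / c) * (ennreal (a' x) * ennreal ((norm (f (a x)))\<^sup>2))"
      using c line_diffeo_pos[OF a, of x] by (simp add: ennreal_mult'[symmetric] ennreal_leI)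
  qed
  also have "\<dots> = ennreal (1 / c) * (\<integral>\<^sup>+x. ennreal ((norm (f x))\<^sup>2) \<partial>lborel)"
    by (simp add: nn_integral_cmult line_diffeo_nn_integral[OF a, of "\<lambda>x. ennreal ((norm (f x))\<^sup>2)"])
  also have "\<dots> \<le> ennreal (1 / c) * ennreal (B\<^sup>2)"
    using f by (intro mult_left_mono) (auto simp: L2_bound_def)
  also have "\<dots> = ennreal ((B / sqrt c)\<^sup>2)"
    using c by (simp add: ennreal_mult'[symmetric] power_divide)
  finally show "(\<integral>\<^sup>+x. ennreal ((norm (f (a x)))\<^sup>2) \<partial>lborel) \<le> ennreal ((B / sqrt c)\<^sup>2)" .
  show "0 \<le> B / sqrt c" using f c by (auto simp: L2_bound_def)
qed

lemma L2_bound_integrable: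
  assumes "L2_bound f B"
  shows "integrable lborel (\<lambda>x. (norm (f x))\<^sup>2)" "(LINT x|lborel. (norm (f x))\<^sup>2) \<le> B\<^sup>2"
proof -
  have [measurable]: "f \<in> borel_measurable borel" using assms by (simp add: L2_bound_def)
  show i: "integrable lborel (\<lambda>x. (norm (f x))\<^sup>2)"
  proof (rule integrableI_bounded)
    show "(\<integral>\<^sup>+x. ennreal (norm ((norm (f x))\<^sup>2)) \<partial>lborel) < \<infinity>"
      using assms by (auto simp: L2_bound_def intro: le_less_trans)
  qed simp
  have "ennreal (LINT x|lborel. (norm (f x))\<^sup>2) \<le> ennreal (B\<^sup>2)"
    using assms i by (subst nn_integral_eq_integral[symmetric]) (auto simp: L2_bound_def)
  then show "(LINT x|lborel. (norm (f x))\<^sup>2) \<le> B\<^sup>2" by simp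
qed

lemma L2_boundI:
  assumes "f \<in> borel_measurable borel" "integrable lborel (\<lambda>x. (norm (f x))\<^sup>2)"
    "(LINT x|lborel. (norm (f x))\<^sup>2) \<le> B\<^sup>2" "0 \<le> B"
  shows "L2_bound f B"
  using assms by (auto simp: L2_bound_def nn_integral_eq_integral ennreal_leI)

lemma L2_bound_AE_cong:
  assumes "L2_bound f B" "g \<in> borel_measurable borel" "AE x in lborel. f x = g x"
  shows "L2_bound g B"
proof -
  have "(\<integral>\<^sup>+x. ennreal ((norm (f x))\<^sup>2) \<partial>lborel) = (\<integral>\<^sup>+x. ennreal ((norm (g x))\<^sup>2) \<partial>lborel)"
    using assms(3) by (intro nn_integral_cong_AE) auto
  then show ?thesis using assms by (simp add: L2_bound_def)
qed

lemma interval_Cauchy_Schwarz: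
  fixes g :: "real \<Rightarrow> 'a::euclidean_space"
  assumes [measurable]: "g \<in> borel_measurable borel" and "u \<le> v"
  shows "(\<integral>\<^sup>+t. indicator {u..v} t * ennreal (norm (g t)) \<partial>lborel)\<^sup>2
    \<le> ennreal (v - u) * (\<integral>\<^sup>+t. indicator {u..v} t * ennreal ((norm (g t))\<^sup>2) \<partial>lborel)"
proof -
  have "(\<integral>\<^sup>+t. indicator {u..v} t * (indicator {u..v} t * ennreal (norm (g t))) \<partial>lborel)\<^sup>2
    \<le> (\<integral>\<^sup>+t. (indicator {u..v} t)\<^sup>2 \<partial>lborel) * (\<integral>\<^sup>+t. (indicator {u..v} t * ennreal (norm (g t)))\<^sup>2 \<partial>lborel)"
    by (rule Cauchy_Schwarz_nn_integral) auto
  moreover have "(\<integral>\<^sup>+t. (indicator {u..v} t)\<^sup>2 \<partial>lborel) = ennreal (v - u)"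
  proof -
    have "(\<lambda>t. (indicator {u..v} t)\<^sup>2) = (indicator {u..v} :: real \<Rightarrow> ennreal)"
      by (auto simp: indicator_def fun_eq_iff)
    then show ?thesis using assms(2) by simp
  qed
  moreover have "(indicator {u..v} t * ennreal (norm (g t)))\<^sup>2 = indicator {u..v} t * ennreal ((norm (g t))\<^sup>2)"
    "indicator {u..v} t * (indicator {u..v} t * ennreal (norm (g t))) = indicator {u..v} t * ennreal (norm (g t))" for t
    by (auto simp: indicator_def ennreal_power)
  ultimately show ?thesis by simp
qed

lemma ac_deriv_norm_diff_le:
  fixes f :: "real \<Rightarrow> 'a::euclidean_space"
  assumes f: "ac_deriv f g" and "x \<in> {u..v}" "y \<in> {u..v}"
  shows "ennreal (norm (f y - f x)) \<le> (\<integral>\<^sup>+t. indicator {u..v} t * ennreal (norm (g t)) \<partial>lborel)"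
proof -
  have main: "ennreal (norm (f y - f x)) \<le> (\<integral>\<^sup>+t. indicator {u..v} t * ennreal (norm (g t)) \<partial>lborel)"
    if "x \<le> y" "u \<le> x" "y \<le> v" for x y
  proof -
    have "ennreal (norm (f y - f x)) = ennreal (norm (LINT t|lborel. indicator {x..y} t *\<^sub>R g t))"
      using ac_deriv_integral[OF f that(1)] by (simp add: set_lebesgue_integral_def)
    also have "\<dots> \<le> (\<integral>\<^sup>+t. norm (indicator {x..y} t *\<^sub>R g t) \<partial>lborel)"
      using ac_deriv_integrable[OF f] by (intro integral_norm_bound_ennreal) (simp add: set_integrable_def)
    also have "\<dots> \<le> (\<integral>\<^sup>+t. indicator {u..v} t * ennreal (norm (g t)) \<partial>lborel)"
      using that by (intro nn_integral_mono) (auto simp: indicator_def)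
    finally show ?thesis .
  qed
  show ?thesis
    using main[of x y] main[of y x] assms(2,3) by (cases "x \<le> y") (auto simp: norm_minus_commute)
qed

text \<open>
  The Sobolev embedding. By Cauchy-Schwarz, \<open>f\<close> oscillates by at most \<open>B\<close> on the unit interval to the right
  of \<open>x\<close>. If \<open>norm (f x)\<close> exceeded \<open>2 * B\<close>, then \<open>norm (f y)\<close> would exceed \<open>B\<close> uniformly on this interval,
  and the square integral of \<open>f\<close> would be too large.
\<close>

lemma sup_le_L2_bounds:
  fixes f :: "real \<Rightarrow> 'a::euclidean_space"
  assumes fg: "ac_deriv f g" and f: "L2_bound f B" and g: "L2_bound g B"
  shows "norm (f x) \<le> 2 * B"
proof (rule ccontr)
  assume "\<not> norm (f x) \<le> 2 * B"
  then have big: "norm (f x) > 2 * B" by simp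
  have [measurable]: "f \<in> borel_measurable borel" "g \<in> borel_measurable borel" and B: "0 \<le> B"
    using f g by (auto simp: L2_bound_def)
  have osc: "norm (f y - f x) \<le> B" if "y \<in> {x..x + 1}" for y
  proof -
    let ?I = "\<integral>\<^sup>+t. indicator {x..x + 1} t * ennreal (norm (g t)) \<partial>lborel"
    have "(ennreal (norm (f y - f x)))\<^sup>2 \<le> ?I\<^sup>2"
      using ac_deriv_norm_diff_le[OF fg, of x x "x + 1" y] that by (intro power_mono) auto
    also have "\<dots> \<le> ennreal (x + 1 - x) * (\<integral>\<^sup>+t. indicator {x..x + 1} t * ennreal ((norm (g t))\<^sup>2) \<partial>lborel)"
      by (rule interval_Cauchy_Schwarz) auto
    also have "\<dots> = (\<integral>\<^sup>+t. indicator {x..x + 1} t * ennreal ((norm (g t))\<^sup>2) \<partial>lborel)" by simp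
    also have "\<dots> \<le> (\<integral>\<^sup>+t. ennreal ((norm (g t))\<^sup>2) \<partial>lborel)"
      by (intro nn_integral_mono) (auto simp: indicator_def)
    also have "\<dots> \<le> ennreal (B\<^sup>2)" using g by (simp add: L2_bound_def)
    finally have "(norm (f y - f x))\<^sup>2 \<le> B\<^sup>2" by (simp add: ennreal_power)
    then show ?thesis using B by (rule power2_le_imp_le)
  qed
  have low: "norm (f x) - B \<le> norm (f y)" if "y \<in> {x..x + 1}" for y
    using osc[OF that] norm_triangle_ineq2[of "f x" "f y"] by (simp add: norm_minus_commute)
  have "ennreal ((norm (f x) - B)\<^sup>2) = (\<integral>\<^sup>+t. indicator {x..x + 1} t * ennreal ((norm (f x) - B)\<^sup>2) \<partial>lborel)"
    by (simp add: nn_integral_multc)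
  also have "\<dots> \<le> (\<integral>\<^sup>+t. ennreal ((norm (f t))\<^sup>2) \<partial>lborel)"
    using low big B by (intro nn_integral_mono) (auto simp: indicator_def intro!: ennreal_leI power_mono)
  also have "\<dots> \<le> ennreal (B\<^sup>2)" using f by (simp add: L2_bound_def)
  finally have "(norm (f x) - B)\<^sup>2 \<le> B\<^sup>2" by simp
  then have "norm (f x) - B \<le> B" using B by (rule power2_le_imp_le)
  then show False using big by simp
qed

text \<open>
  By Cauchy-Schwarz, the square of \<open>norm (f x - f (d x))\<close> is at most \<open>2 * M\<close> times the integral of the
  square of \<open>g\<close> over \<open>{x - M..x + M}\<close>. Integrating over \<open>x\<close> and exchanging the integrals gives another
  factor \<open>2 * M\<close>, as each \<open>t\<close> lies in this window for a set of \<open>x\<close> of length \<open>2 * M\<close>. This serves to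
  bound the displacement of a phase that need not be square integrable itself.
\<close>

lemma L2_bound_displacement:
  assumes fg: "ac_deriv f g" and g: "L2_bound g B" and M: "0 \<le> M"
    and d: "\<And>x. \<bar>d x - x\<bar> \<le> M" and [measurable]: "d \<in> borel_measurable borel"
  shows "L2_bound (\<lambda>x. f x - f (d x)) (2 * M * B)"
  unfolding L2_bound_def
proof (intro conjI)
  have [measurable]: "g \<in> borel_measurable borel" and B: "0 \<le> B" using g by (auto simp: L2_bound_def)
  have [measurable]: "f \<in> borel_measurable borel"
    by (rule borel_measurable_continuous_onI[OF ac_deriv_continuous[OF fg]])
  show "(\<lambda>x. f x - f (d x)) \<in> borel_measurable borel" by measurable
  show "0 \<le> 2 * M * B" using M B by simp
  let ?h = "\<lambda>t. ennreal ((norm (g t))\<^sup>2)"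
  \<comment> \<open>the window is symmetric in \<open>x\<close> and \<open>t\<close>, and jointly measurable in this form\<close>
  define w :: "real \<Rightarrow> real \<Rightarrow> ennreal" where "w x t = (if x - M \<le> t \<and> t \<le> x + M then 1 else 0)" for x t
  have w: "indicator {x - M..x + M} t = w x t" "w x t = indicator {t - M..t + M} x" for x t
    by (auto simp: indicator_def w_def)
  have [measurable]: "(\<lambda>(x, t). w x t) \<in> borel_measurable (lborel \<Otimes>\<^sub>M lborel)"
    unfolding w_def by measurable
  have "(\<integral>\<^sup>+x. ennreal ((norm (f x - f (d x)))\<^sup>2) \<partial>lborel)
      \<le> (\<integral>\<^sup>+x. ennreal (2 * M) * (\<integral>\<^sup>+t. indicator {x - M..x + M} t * ?h t \<partial>lborel) \<partial>lborel)"
  proof (rule nn_integral_mono)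
    fix x
    have "d x \<in> {x - M..x + M}" "x \<in> {x - M..x + M}" using d[of x] M by (auto simp: abs_le_iff)
    from ac_deriv_norm_diff_le[OF fg this]
    have "(ennreal (norm (f x - f (d x))))\<^sup>2 \<le> (\<integral>\<^sup>+t. indicator {x - M..x + M} t * ennreal (norm (g t)) \<partial>lborel)\<^sup>2"
      by (intro power_mono) auto
    also have "\<dots> \<le> ennreal (x + M - (x - M)) * (\<integral>\<^sup>+t. indicator {x - M..x + M} t * ?h t \<partial>lborel)"
      using M by (intro interval_Cauchy_Schwarz) auto
    also have "x + M - (x - M) = 2 * M" by simp
    finally show "ennreal ((norm (f x - f (d x)))\<^sup>2) \<le> ennreal (2 * M) * (\<integral>\<^sup>+t. indicator {x - M..x + M} t * ?h t \<partial>lborel)"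
      by (simp only: ennreal_power norm_ge_zero)
  qed
  also have "\<dots> = (\<integral>\<^sup>+x. ennreal (2 * M) * (\<integral>\<^sup>+t. w x t * ?h t \<partial>lborel) \<partial>lborel)"
    by (simp only: w(1))
  also have "\<dots> = ennreal (2 * M) * (\<integral>\<^sup>+x. (\<integral>\<^sup>+t. w x t * ?h t \<partial>lborel) \<partial>lborel)"
    by (rule nn_integral_cmult) measurable
  also have "(\<integral>\<^sup>+x. (\<integral>\<^sup>+t. w x t * ?h t \<partial>lborel) \<partial>lborel)
      = (\<integral>\<^sup>+t. (\<integral>\<^sup>+x. w x t * ?h t \<partial>lborel) \<partial>lborel)"
    by (rule lborel_pair.Fubini'[symmetric]) measurable
  also have "\<dots> = (\<integral>\<^sup>+t. ennreal (2 * M) * ?h t \<partial>lborel)"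
  proof (rule nn_integral_cong)
    fix t
    have "(\<integral>\<^sup>+x. w x t * ?h t \<partial>lborel) = (\<integral>\<^sup>+x. indicator {t - M..t + M} x \<partial>lborel) * ?h t"
      unfolding w(2) by (rule nn_integral_multc) simp
    also have "(\<integral>\<^sup>+x. indicator {t - M..t + M} x \<partial>lborel) = ennreal (t + M - (t - M))"
      using M by (simp only: nn_integral_indicator sets_lborel atLeastAtMost_borel) (rule emeasure_lborel_Icc, simp)
    also have "t + M - (t - M) = 2 * M" by simp
    finally show "(\<integral>\<^sup>+x. w x t * ?h t \<partial>lborel) = ennreal (2 * M) * ?h t" .
  qed
  also have "\<dots> = ennreal (2 * M) * (\<integral>\<^sup>+t. ?h t \<partial>lborel)" by (rule nn_integral_cmult) simp
  also have "ennreal (2 * M) * (ennreal (2 * M) * (\<integral>\<^sup>+t. ?h t \<partial>lborel)) \<le> ennreal (2 * M) * (ennreal (2 * M) * ennreal (B\<^sup>2))"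
    using g by (intro mult_left_mono) (auto simp: L2_bound_def)
  also have "\<dots> = ennreal (2 * M * (2 * M * B\<^sup>2))"
    using M by (simp only: ennreal_mult' mult_nonneg_nonneg zero_le_numeral)
  also have "2 * M * (2 * M * B\<^sup>2) = (2 * M * B)\<^sup>2" by (simp add: power2_eq_square)
  finally show "(\<integral>\<^sup>+x. ennreal ((norm (f x - f (d x)))\<^sup>2) \<partial>lborel) \<le> ennreal ((2 * M * B)\<^sup>2)" .
qed

section \<open>Sobolev functions with classical derivatives\<close>

text \<open>
  A constant bounds the \<open>L\<^sup>2\<close> norms of \<open>f\<close> and of its derivatives up to order \<open>k\<close>. Those of
  order below \<open>k\<close>, with \<open>f\<close> as order zero, are the locally absolutely continuous representatives; the
  one of order \<open>k\<close> matters only up to null sets.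
\<close>

primrec Hk_bound :: "nat \<Rightarrow> (real \<Rightarrow> 'a::euclidean_space) \<Rightarrow> real \<Rightarrow> bool" where
  "Hk_bound 0 f B \<longleftrightarrow> L2_bound f B"
| "Hk_bound (Suc k) f B \<longleftrightarrow> L2_bound f B \<and> (\<exists>g. ac_deriv f g \<and> Hk_bound k g B)"

lemma Hk_bound_L2: "Hk_bound k f B \<Longrightarrow> L2_bound f B"
  by (cases k) auto

lemma Hk_bound_nonneg: "Hk_bound k f B \<Longrightarrow> 0 \<le> B"
  by (drule Hk_bound_L2) (simp add: L2_bound_def)

lemma Hk_bound_measurable: "Hk_bound k f B \<Longrightarrow> f \<in> borel_measurable borel"
  by (drule Hk_bound_L2) (simp add: L2_bound_def)

lemma Hk_bound_Suc_imp: "Hk_bound (Suc k) f B \<Longrightarrow> Hk_bound k f B"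
proof (induction k arbitrary: f)
  case 0 then show ?case by simp
next
  case (Suc k)
  then obtain g where "ac_deriv f g" "Hk_bound (Suc k) g B" by auto
  then show ?case using Suc by auto
qed

lemma Hk_bound_mono: "Hk_bound k f A \<Longrightarrow> A \<le> B \<Longrightarrow> Hk_bound k f B"
  by (induction k arbitrary: f) (auto intro: L2_bound_mono)

lemma Hk_bound_add:
  "Hk_bound k f A \<Longrightarrow> Hk_bound k g B \<Longrightarrow> Hk_bound k (\<lambda>x. f x + g x) (2 * (A + B))"
proof (induction k arbitrary: f g)
  case 0
  then show ?case unfolding Hk_bound.simps by (rule L2_bound_add)
next
  case (Suc k)
  then obtain f' g' where d: "ac_deriv f f'" "Hk_bound k f' A" "ac_deriv g g'" "Hk_bound k g' B" by auto
  have "Hk_bound k (\<lambda>x. f' x + g' x) (2 * (A + B))" by (rule Suc.IH[OF d(2,4)])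
  then show ?case
    unfolding Hk_bound.simps
    using ac_deriv_add[OF d(1,3)] L2_bound_add[OF Hk_bound_L2[OF Suc.prems(1)] Hk_bound_L2[OF Suc.prems(2)]]
    by blast
qed

lemma L2_bound_prod:
  fixes p :: "real \<Rightarrow> 'b::euclidean_space" and f :: "real \<Rightarrow> 'a::euclidean_space"
    and prod :: "'b \<Rightarrow> 'a \<Rightarrow> 'c::euclidean_space"
  assumes prod: "bounded_bilinear prod" and le: "\<And>u v. norm (prod u v) \<le> norm u * norm v"
    and p: "Ck_bound k p K" and f: "L2_bound f B"
  shows "L2_bound (\<lambda>x. prod (p x) (f x)) (K * B)"
proof (rule L2_bound_dominated[OF f])
  interpret bounded_bilinear prod by fact
  have [measurable]: "f \<in> borel_measurable borel" "p \<in> borel_measurable borel"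
    using f borel_measurable_continuous_onI[OF Ck_bound_continuous[OF p]] by (auto simp: L2_bound_def)
  have "(\<lambda>z. prod (fst z) (snd z)) \<in> borel_measurable (borel :: ('b \<times> 'a) measure)"
    by (intro borel_measurable_continuous_onI continuous_on continuous_intros)
  then have "(\<lambda>z. prod (fst z) (snd z)) \<circ> (\<lambda>x. (p x, f x)) \<in> borel_measurable borel"
    by (intro measurable_comp) auto
  then show "(\<lambda>x. prod (p x) (f x)) \<in> borel_measurable borel" by (simp add: o_def)
  show "0 \<le> K" by (rule Ck_bound_nonneg[OF p])
  show "norm (prod (p x) (f x)) \<le> K * norm (f x)" for x
    using le[of "p x" "f x"] mult_right_mono[OF Ck_bound_norm[OF p, of x] norm_ge_zero[of "f x"]] by linarith
qed

text \<open>
  The product is an arbitrary bilinear map of norm at most one, as real factors occur both as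
  multipliers of vector-valued functions and multiplied by them.
\<close>

lemma Hk_bound_prod:
  fixes p :: "real \<Rightarrow> 'b::euclidean_space" and f :: "real \<Rightarrow> 'a::euclidean_space"
    and prod :: "'b \<Rightarrow> 'a \<Rightarrow> 'c::euclidean_space"
  assumes prod: "bounded_bilinear prod" and le: "\<And>u v. norm (prod u v) \<le> norm u * norm v"
  shows "Ck_bound k p K \<Longrightarrow> Hk_bound k f B \<Longrightarrow> Hk_bound k (\<lambda>x. prod (p x) (f x)) (4 ^ k * (K * B))"
proof (induction k arbitrary: p f)
  case 0
  then show ?case using L2_bound_prod[OF prod le 0(1), of f B] by simp
next
  case (Suc k)
  obtain p' where p': "\<And>x. (p has_vector_derivative p' x) (at x)" "Ck_bound k p' K" using Suc.prems(1) by auto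
  obtain g where g: "ac_deriv f g" "Hk_bound k g B" using Suc.prems(2) by auto
  have KB: "0 \<le> K * B" using Ck_bound_nonneg[OF Suc.prems(1)] Hk_bound_nonneg[OF Suc.prems(2)] by simp
  have ac: "ac_deriv (\<lambda>x. prod (p x) (f x)) (\<lambda>x. prod (p' x) (f x) + prod (p x) (g x))"
    by (intro ac_deriv_prod[OF prod] p' g Ck_bound_continuous[OF p'(2)])
  have "Hk_bound k (\<lambda>x. prod (p' x) (f x) + prod (p x) (g x)) (2 * (4 ^ k * (K * B) + 4 ^ k * (K * B)))"
    by (intro Hk_bound_add Suc.IH p' g Ck_bound_Suc_imp[OF Suc.prems(1)] Hk_bound_Suc_imp[OF Suc.prems(2)])
  moreover have "2 * (4 ^ k * (K * B) + 4 ^ k * (K * B)) = 4 ^ Suc k * (K * B)" by simp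
  moreover have "L2_bound (\<lambda>x. prod (p x) (f x)) (4 ^ Suc k * (K * B))"
    using KB mult_right_mono[of 1 "4 ^ Suc k" "K * B"]
    by (intro L2_bound_mono[OF L2_bound_prod[OF prod le Suc.prems(1) Hk_bound_L2[OF Suc.prems(2)]]])
       (simp only: one_le_power mult_1_left)
  ultimately show ?case using ac by (simp only: Hk_bound.simps) blast
qed

lemma Hk_bound_comp:
  assumes c: "c > 0"
  shows "\<exists>C\<ge>0. \<forall>a a' (f :: real \<Rightarrow> 'a::euclidean_space) B. line_diffeo c a a' \<longrightarrow> Ck_bound k a' K \<longrightarrow>
     Hk_bound k f B \<longrightarrow> Hk_bound k (\<lambda>x. f (a x)) (C * B)"
proof (induction k)
  case 0
  show ?case
  proof (intro exI[of _ "1 / sqrt c"] conjI allI impI)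
    show "0 \<le> 1 / sqrt c" using c by simp
    fix a a' and f :: "real \<Rightarrow> 'a" and B
    assume "line_diffeo c a a'" "Hk_bound 0 f B"
    then have "L2_bound (\<lambda>x. f (a x)) (B / sqrt c)" by (intro L2_bound_comp) auto
    then show "Hk_bound 0 (\<lambda>x. f (a x)) (1 / sqrt c * B)" by simp
  qed
next
  case (Suc k)
  then obtain C where C: "C \<ge> 0" "\<And>a a' (f :: real \<Rightarrow> 'a) B. line_diffeo c a a' \<Longrightarrow> Ck_bound k a' K \<Longrightarrow>
     Hk_bound k f B \<Longrightarrow> Hk_bound k (\<lambda>x. f (a x)) (C * B)" by blast
  let ?D = "max (1 / sqrt c) (4 ^ k * (K * C))"
  show ?case
  proof (intro exI[of _ ?D] conjI allI impI)
    show "0 \<le> ?D" using c by (simp add: le_max_iff_disj)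
    fix a a' and f :: "real \<Rightarrow> 'a" and B
    assume a: "line_diffeo c a a'" and a': "Ck_bound (Suc k) a' K" and f: "Hk_bound (Suc k) f B"
    obtain g where g: "ac_deriv f g" "Hk_bound k g B" using f by auto
    have B: "0 \<le> B" using Hk_bound_nonneg[OF f] .
    have "Hk_bound k (\<lambda>x. a' x *\<^sub>R g (a x)) (4 ^ k * (K * (C * B)))"
      by (intro Hk_bound_prod[OF bounded_bilinear_scaleR] C(2)[OF a] g Ck_bound_Suc_imp[OF a']) auto
    then have "Hk_bound k (\<lambda>x. a' x *\<^sub>R g (a x)) (?D * B)"
    proof (rule Hk_bound_mono)
      have "4 ^ k * (K * C) * B \<le> ?D * B" using B by (rule mult_right_mono[OF max.cobounded2])
      then show "4 ^ k * (K * (C * B)) \<le> ?D * B" by (simp only: mult.assoc)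
    qed
    moreover have "L2_bound (\<lambda>x. f (a x)) (?D * B)"
      using L2_bound_comp[OF a Hk_bound_L2[OF f]]
    proof (rule L2_bound_mono)
      have "1 / sqrt c * B \<le> ?D * B" using B by (intro mult_right_mono) auto
      then show "B / sqrt c \<le> ?D * B" by simp
    qed
    ultimately show "Hk_bound (Suc k) (\<lambda>x. f (a x)) (?D * B)"
      unfolding Hk_bound.simps using ac_deriv_comp[OF a g(1)] by blast
  qed
qed

text \<open>The derivative of order \<open>k + 1\<close> is spent on the uniform bound for the one of order \<open>k\<close>.\<close>

lemma Hk_bound_imp_Ck_bound:
  "Hk_bound (Suc k) f B \<Longrightarrow> Ck_bound k f (2 * B)"
proof (induction k arbitrary: f)
  case 0
  then obtain g where "ac_deriv f g" "L2_bound f B" "L2_bound g B" by auto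
  then show ?case using ac_deriv_continuous[of f g] sup_le_L2_bounds[of f g B] by auto
next
  case (Suc k)
  then obtain g where g: "ac_deriv f g" "Hk_bound (Suc k) g B" by auto
  have ck: "Ck_bound k g (2 * B)" by (rule Suc.IH[OF g(2)])
  show ?case
  proof (rule Ck_bound_SucI[OF _ _ ck])
    show "norm (f x) \<le> 2 * B" for x
      using sup_le_L2_bounds[OF g(1) Hk_bound_L2[OF Suc.prems] Hk_bound_L2[OF g(2)]] .
    show "(f has_vector_derivative g x) (at x)" for x
      by (rule ac_deriv_has_vector_derivative[OF g(1) Ck_bound_continuous[OF ck]])
  qed simp
qed

text \<open>
  In order zero, the mean value inequality applies. In order \<open>k + 1\<close>, the derivative of \<open>\<phi> \<circ> c - \<phi>\<close> is
  \<open>(\<phi>' \<circ> c - \<phi>') + (c' - 1) \<cdot> (\<phi>' \<circ> c)\<close>: the first term is of the same kind with \<open>\<phi>'\<close> for \<open>\<phi>\<close>, and the second is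
  a bounded multiple of \<open>c' - 1\<close>. Both are linear in the distance of \<open>c\<close> to the identity.
\<close>

lemma Hk_bound_comp_near_id:
  fixes \<phi> :: "real \<Rightarrow> 'a::euclidean_space"
  assumes "Ck_bound (Suc k) \<phi> L"
  shows "\<exists>C\<ge>0. \<forall>c c' B. (\<forall>x. (c has_vector_derivative c' x) (at x)) \<longrightarrow> Ck_bound k c' K \<longrightarrow>
     L2_bound (\<lambda>x. c x - x) B \<longrightarrow> Hk_bound k (\<lambda>x. c' x - 1) B \<longrightarrow>
     Hk_bound k (\<lambda>x. \<phi> (c x) - \<phi> x) (C * B)"
  using assms
proof (induction k arbitrary: \<phi>)
  have base: "L2_bound (\<lambda>x. \<phi> (c x) - \<phi> x) (L * B)"
    if \<phi>: "Ck_bound (Suc k) \<phi> L" and c: "continuous_on UNIV c" and B: "L2_bound (\<lambda>x. c x - x) B"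
    for k c B and \<phi> :: "real \<Rightarrow> 'a"
  proof (rule L2_bound_dominated[OF B])
    obtain \<phi>' where d: "\<And>x. (\<phi> has_vector_derivative \<phi>' x) (at x)" "Ck_bound k \<phi>' L" using \<phi> by auto
    show "(\<lambda>x. \<phi> (c x) - \<phi> x) \<in> borel_measurable borel"
      by (intro borel_measurable_continuous_onI continuous_intros Ck_bound_continuous[OF \<phi>]
          continuous_on_compose2[OF Ck_bound_continuous[OF \<phi>] c]) auto
    show "0 \<le> L" by (rule Ck_bound_nonneg[OF \<phi>])
    show "norm (\<phi> (c x) - \<phi> x) \<le> L * norm (c x - x)" for x
    proof (rule differentiable_bound[of UNIV])
      show "(\<phi> has_derivative (\<lambda>h. h *\<^sub>R \<phi>' x)) (at x within UNIV)" for x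
        using d(1)[of x] by (simp add: has_vector_derivative_def)
      show "onorm (\<lambda>h. h *\<^sub>R \<phi>' x) \<le> L" for x
        using mult_right_mono[OF Ck_bound_norm[OF d(2), of x] abs_ge_zero]
        by (intro onorm_le) (simp add: mult.commute)
    qed auto
  qed
  {
    case 0
    have L: "0 \<le> L" by (rule Ck_bound_nonneg[OF 0])
    show ?case
    proof (intro exI[of _ L] conjI allI impI L)
      fix c c' B assume "\<forall>x. (c has_vector_derivative c' x) (at x)" "L2_bound (\<lambda>x. c x - x) B"
      then have "L2_bound (\<lambda>x. \<phi> (c x) - \<phi> x) (L * B)"
        by (intro base[OF 0] has_vector_derivative_continuous_on) blast+
      then show "Hk_bound 0 (\<lambda>x. \<phi> (c x) - \<phi> x) (L * B)" by simp
    qed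
  next
    case (Suc k)
    obtain \<phi>' where d: "\<And>x. (\<phi> has_vector_derivative \<phi>' x) (at x)" "Ck_bound (Suc k) \<phi>' L" using Suc.prems by auto
    have L: "0 \<le> L" by (rule Ck_bound_nonneg[OF d(2)])
    obtain C where C: "C \<ge> 0" "\<And>c c' B. (\<And>x. (c has_vector_derivative c' x) (at x)) \<Longrightarrow> Ck_bound k c' K \<Longrightarrow>
     L2_bound (\<lambda>x. c x - x) B \<Longrightarrow> Hk_bound k (\<lambda>x. c' x - 1) B \<Longrightarrow>
     Hk_bound k (\<lambda>x. \<phi>' (c x) - \<phi>' x) (C * B)" using Suc.IH[OF d(2)] by blast
    obtain D where D: "\<And>(f :: real \<Rightarrow> 'a) c c'. Ck_bound k f L \<Longrightarrow>
      (\<And>x. (c has_vector_derivative c' x) (at x)) \<Longrightarrow> Ck_bound k c' K \<Longrightarrow> Ck_bound k (\<lambda>x. f (c x)) D"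
      using Ck_bound_comp[of k L K] by blast
    let ?E = "max L (2 * (C + 4 ^ k * D))"
    show ?case
    proof (intro exI[of _ ?E] conjI allI impI)
      show "0 \<le> ?E" using L by (simp add: le_max_iff_disj)
      fix c c' B
      assume c: "\<forall>x. (c has_vector_derivative c' x) (at x)" and c': "Ck_bound (Suc k) c' K"
        and B: "L2_bound (\<lambda>x. c x - x) B" and Hk: "Hk_bound (Suc k) (\<lambda>x. c' x - 1) B"
      have B0: "0 \<le> B" using B by (simp add: L2_bound_def)
      have cont: "continuous_on UNIV c" using c has_vector_derivative_continuous_on by blast
      have Dc: "Ck_bound k (\<lambda>x. \<phi>' (c x)) D"
        using c by (intro D[OF Ck_bound_Suc_imp[OF d(2)] _ Ck_bound_Suc_imp[OF c']]) auto
      let ?g = "\<lambda>x. (\<phi>' (c x) - \<phi>' x) + (c' x - 1) *\<^sub>R \<phi>' (c x)"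
      have "((\<lambda>x. \<phi> (c x) - \<phi> x) has_vector_derivative ?g x) (at x)" for x
      proof -
        have "((\<lambda>x. \<phi> (c x) - \<phi> x) has_vector_derivative c' x *\<^sub>R \<phi>' (c x) - \<phi>' x) (at x)"
          using vector_diff_chain_at[OF c[rule_format, of x] d(1)]
          by (intro has_vector_derivative_diff d) (simp add: o_def)
        then show ?thesis by (simp add: algebra_simps)
      qed
      moreover have "continuous_on UNIV ?g"
        by (intro continuous_intros Ck_bound_continuous[OF c'] Ck_bound_continuous[OF d(2)]
            continuous_on_compose2[OF Ck_bound_continuous[OF d(2)] cont]) auto
      ultimately have ac: "ac_deriv (\<lambda>x. \<phi> (c x) - \<phi> x) ?g" by (rule ac_deriv_C1)
      have "Hk_bound k (\<lambda>x. (c' x - 1) *\<^sub>R \<phi>' (c x)) (4 ^ k * (D * B))"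
        by (rule Hk_bound_prod[OF bounded_bilinear.flip[OF bounded_bilinear_scaleR] _ Dc Hk_bound_Suc_imp[OF Hk]])
           (simp add: mult.commute)
      then have "Hk_bound k ?g (2 * (C * B + 4 ^ k * (D * B)))"
        using c by (intro Hk_bound_add C(2)[OF _ Ck_bound_Suc_imp[OF c'] B Hk_bound_Suc_imp[OF Hk]]) auto
      then have "Hk_bound k ?g (?E * B)"
      proof (rule Hk_bound_mono)
        have "2 * (C * B + 4 ^ k * (D * B)) = 2 * (C + 4 ^ k * D) * B" by (simp add: algebra_simps)
        also have "\<dots> \<le> ?E * B" using B0 by (rule mult_right_mono[OF max.cobounded2])
        finally show "2 * (C * B + 4 ^ k * (D * B)) \<le> ?E * B" .
      qed
      moreover have "L2_bound (\<lambda>x. \<phi> (c x) - \<phi> x) (?E * B)"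
        by (rule L2_bound_mono[OF base[OF Suc.prems cont B] mult_right_mono[OF max.cobounded1 B0]])
      ultimately show "Hk_bound (Suc k) (\<lambda>x. \<phi> (c x) - \<phi> x) (?E * B)"
        unfolding Hk_bound.simps using ac by blast
    qed
  }
qed

section \<open>Comparison with the Sobolev norm by weak derivatives\<close>

lemma L2_bound_locally_integrable:
  assumes "L2_bound f B"
  shows "locally_integrable f"
  unfolding locally_integrable_def set_integrable_def
proof (intro allI)
  fix a b :: real
  have [measurable]: "f \<in> borel_measurable borel" using assms by (simp add: L2_bound_def)
  show "integrable lborel (\<lambda>x. indicator {a..b} x *\<^sub>R f x)"
  proof (rule Bochner_Integration.integrable_bound)
    show "integrable lborel (\<lambda>x. indicator {a..b} x + (norm (f x))\<^sup>2)"
      by (intro Bochner_Integration.integrable_add L2_bound_integrable[OF assms]) (simp add: integrable_indicator_iff emeasure_lborel_Icc_eq)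
    have "norm (f x) \<le> 1 + (norm (f x))\<^sup>2" for x
    proof -
      have "0 \<le> (norm (f x) - 1)\<^sup>2 + norm (f x)" by simp
      then show ?thesis by (simp add: power2_diff)
    qed
    then show "AE x in lborel. norm (indicator {a..b} x *\<^sub>R f x) \<le> norm (indicator {a..b} x + (norm (f x))\<^sup>2)"
      by (intro AE_I2) (simp add: indicator_def)
  qed simp
qed

lemma Hk_bound_derivatives:
  "Hk_bound k f B \<Longrightarrow>
     \<exists>D. D 0 = f \<and> (\<forall>j<k. ac_deriv (D j) (D (Suc j))) \<and> (\<forall>j\<le>k. L2_bound (D j) B)"
proof (induction k arbitrary: f)
  case 0
  then show ?case by (intro exI[of _ "\<lambda>_. f"]) auto
next
  case (Suc k)
  then obtain g where g: "ac_deriv f g" "Hk_bound k g B" and f: "L2_bound f B" by auto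
  obtain D where D: "D 0 = g" "\<forall>j<k. ac_deriv (D j) (D (Suc j))" "\<forall>j\<le>k. L2_bound (D j) B"
    using Suc.IH[OF g(2)] by blast
  let ?E = "\<lambda>j. case j of 0 \<Rightarrow> f | Suc i \<Rightarrow> D i"
  have "ac_deriv (?E j) (?E (Suc j))" if "j < Suc k" for j
    using that g D by (cases j) auto
  moreover have "L2_bound (?E j) B" if "j \<le> Suc k" for j
    using that f D by (cases j) auto
  ultimately show ?case by (intro exI[of _ ?E]) auto
qed

text \<open>
  Integration by parts \<open>j\<close> times, each time with the next derivative of the test function, shows that the
  classical derivatives are weak ones.
\<close>

lemma sobolev_norm_le:
  fixes f f0 :: "real \<Rightarrow> 'a::euclidean_space"
  assumes f0: "Hk_bound k f0 B" and f: "f \<in> borel_measurable borel" and eq: "AE x in lborel. f0 x = f x"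
  shows "sobolev_norm k f \<le> ereal (real (Suc k) * B)"
proof -
  have B: "0 \<le> B" by (rule Hk_bound_nonneg[OF f0])
  obtain D where D: "D 0 = f0" "\<And>j. j < k \<Longrightarrow> ac_deriv (D j) (D (Suc j))" "\<And>j. j \<le> k \<Longrightarrow> L2_bound (D j) B"
    using Hk_bound_derivatives[OF f0] by blast
  have li: "locally_integrable f"
    by (rule L2_bound_locally_integrable[OF L2_bound_AE_cong[OF Hk_bound_L2[OF f0] f eq]])
  have weak: "(LINT x|lborel. (dx ^^ j) \<eta> x *\<^sub>R f x) = (-1) ^ j *\<^sub>R (LINT x|lborel. \<eta> x *\<^sub>R D j x)"
    if "test_function \<eta>" "j \<le> k" for \<eta> j
    using that
  proof (induction j arbitrary: \<eta>)
    case 0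
    have [measurable]: "\<eta> \<in> borel_measurable borel" "f \<in> borel_measurable borel" "f0 \<in> borel_measurable borel"
      using borel_measurable_continuous_onI[OF test_function_continuous[OF 0(1)]] f Hk_bound_measurable[OF f0] by auto
    have "AE x in lborel. \<eta> x *\<^sub>R f x = \<eta> x *\<^sub>R f0 x" using eq by eventually_elim simp
    then have "(LINT x|lborel. \<eta> x *\<^sub>R f x) = (LINT x|lborel. \<eta> x *\<^sub>R f0 x)"
      by (intro integral_cong_AE) auto
    then show ?case by (simp add: D)
  next
    case (Suc j)
    have "(LINT x|lborel. (dx ^^ Suc j) \<eta> x *\<^sub>R f x) = (LINT x|lborel. (dx ^^ j) (dx \<eta>) x *\<^sub>R f x)"
      by (simp only: funpow_Suc_right comp_apply)
    also have "\<dots> = (-1) ^ j *\<^sub>R (LINT x|lborel. dx \<eta> x *\<^sub>R D j x)"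
      using Suc.prems by (intro Suc.IH test_function_dx) auto
    also have "(LINT x|lborel. dx \<eta> x *\<^sub>R D j x) = - (LINT x|lborel. \<eta> x *\<^sub>R D (Suc j) x)"
      using Suc.prems by (intro ac_deriv_weak_derivative D) auto
    finally show ?case by simp
  qed
  have mem: "D \<in> {D. \<forall>j\<le>k. has_weak_derivative j f (D j) \<and> integrable lborel (\<lambda>x. (norm (D j x))\<^sup>2)}"
    using li weak L2_bound_locally_integrable[OF D(3)] L2_bound_integrable(1)[OF D(3)]
    by (auto simp: has_weak_derivative_def)
  have "(\<Sum>j\<le>k. LINT x|lborel. (norm (D j x))\<^sup>2) \<le> (\<Sum>j\<le>k. B\<^sup>2)"
    by (intro sum_mono L2_bound_integrable(2) D) simp
  also have "\<dots> = real (Suc k) * B\<^sup>2" by simp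
  also have "\<dots> \<le> (real (Suc k))\<^sup>2 * B\<^sup>2"
    by (intro mult_right_mono) (simp_all add: power2_eq_square)
  finally have "sqrt (\<Sum>j\<le>k. LINT x|lborel. (norm (D j x))\<^sup>2) \<le> real (Suc k) * B"
    using B by (intro real_le_lsqrt) (auto simp: power_mult_distrib)
  then show ?thesis
    unfolding sobolev_norm_def by (intro INF_lower2[OF mem]) simp
qed

text \<open>
  The induction starts from the highest derivative: once \<open>D 1\<close> has been replaced by a good representative
  \<open>g\<close>, so can \<open>D 0\<close> by an indefinite integral of \<open>g\<close>.
\<close>

lemma weak_derivatives_imp_Hk_bound:
  fixes D :: "nat \<Rightarrow> real \<Rightarrow> 'a::euclidean_space"
  assumes "\<And>j. j \<le> k \<Longrightarrow> L2_bound (D j) B"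
    and "\<And>j \<eta>. j < k \<Longrightarrow> test_function \<eta> \<Longrightarrow>
      (LINT x|lborel. dx \<eta> x *\<^sub>R D j x) = - (LINT x|lborel. \<eta> x *\<^sub>R D (Suc j) x)"
  shows "\<exists>h. (AE x in lborel. D 0 x = h x) \<and> Hk_bound k h B"
  using assms
proof (induction k arbitrary: D)
  case 0
  then show ?case by (intro exI[of _ "D 0"]) auto
next
  case (Suc k)
  have "\<exists>h. (AE x in lborel. D (Suc 0) x = h x) \<and> Hk_bound k h B"
    by (rule Suc.IH[of "\<lambda>j. D (Suc j)"]) (use Suc.prems in auto)
  then obtain g where g: "AE x in lborel. D (Suc 0) x = g x" "Hk_bound k g B" by blast
  have D0: "L2_bound (D 0) B" and D1: "L2_bound (D (Suc 0)) B" using Suc.prems(1) by auto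
  obtain h where h: "ac_deriv h g" "AE x in lborel. D 0 x = h x"
  proof (rule weak_derivative_imp_ac_deriv)
    show "locally_integrable (D 0)" by (rule L2_bound_locally_integrable[OF D0])
    show "locally_integrable g" by (rule L2_bound_locally_integrable[OF Hk_bound_L2[OF g(2)]])
    fix \<eta> assume \<eta>: "test_function \<eta>"
    have [measurable]: "\<eta> \<in> borel_measurable borel" "D (Suc 0) \<in> borel_measurable borel" "g \<in> borel_measurable borel"
      using borel_measurable_continuous_onI[OF test_function_continuous[OF \<eta>]] D1 Hk_bound_measurable[OF g(2)]
      by (auto simp: L2_bound_def)
    have "AE x in lborel. \<eta> x *\<^sub>R D (Suc 0) x = \<eta> x *\<^sub>R g x" using g(1) by eventually_elim simp
    then have "(LINT x|lborel. \<eta> x *\<^sub>R D (Suc 0) x) = (LINT x|lborel. \<eta> x *\<^sub>R g x)"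
      by (intro integral_cong_AE) auto
    then show "(LINT x|lborel. dx \<eta> x *\<^sub>R D 0 x) = - (LINT x|lborel. \<eta> x *\<^sub>R g x)"
      using Suc.prems(2)[OF _ \<eta>, of 0] by simp
  qed
  have "h \<in> borel_measurable borel"
    by (rule borel_measurable_continuous_onI[OF ac_deriv_continuous[OF h(1)]])
  then have "L2_bound h B" by (rule L2_bound_AE_cong[OF D0 _ h(2)])
  then show ?case using h g by auto
qed

text \<open>
  The \<open>j\<close>-th weak derivative of \<open>f\<close> has the next one as its first weak derivative: test with
  \<open>dx \<eta>\<close> in order \<open>j\<close> and with \<open>\<eta>\<close> in order \<open>j + 1\<close>. The identity in order zero says \<open>f = D 0\<close> almost
  everywhere.
\<close>

lemma sobolev_norm_less_imp:
  fixes f :: "real \<Rightarrow> 'a::euclidean_space"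
  assumes "sobolev_norm k f < ereal B"
  obtains h where "locally_integrable f" "AE x in lborel. f x = h x" "Hk_bound k h B"
proof -
  obtain D where weak: "\<And>j. j \<le> k \<Longrightarrow> has_weak_derivative j f (D j)"
    and int: "\<And>j. j \<le> k \<Longrightarrow> integrable lborel (\<lambda>x. (norm (D j x))\<^sup>2)"
    and less: "sqrt (\<Sum>j\<le>k. LINT x|lborel. (norm (D j x))\<^sup>2) < B"
    using assms unfolding sobolev_norm_def INF_less_iff by auto
  have li: "locally_integrable (D j)" if "j \<le> k" for j
    using weak[OF that] by (simp add: has_weak_derivative_def)
  have f: "locally_integrable f" using weak[of 0] by (simp add: has_weak_derivative_def)
  have B: "0 \<le> B"
  proof -
    have "0 \<le> sqrt (\<Sum>j\<le>k. LINT x|lborel. (norm (D j x))\<^sup>2)"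
      by (intro real_sqrt_ge_zero sum_nonneg) simp
    then show ?thesis using less by linarith
  qed
  have L2: "L2_bound (D j) B" if "j \<le> k" for j
  proof (rule L2_boundI)
    have "(LINT x|lborel. (norm (D j x))\<^sup>2) \<le> (\<Sum>j\<le>k. LINT x|lborel. (norm (D j x))\<^sup>2)"
      using that by (intro member_le_sum) auto
    also have "\<dots> \<le> B\<^sup>2" using less by (intro sqrt_le_D) simp
    finally show "(LINT x|lborel. (norm (D j x))\<^sup>2) \<le> B\<^sup>2" .
  qed (use that B int locally_integrable_measurable[OF li] in auto)
  have "\<exists>h. (AE x in lborel. D 0 x = h x) \<and> Hk_bound k h B"
  proof (rule weak_derivatives_imp_Hk_bound[OF L2])
    fix j \<eta> assume j: "j < k" and \<eta>: "test_function \<eta>"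
    have "(LINT x|lborel. (dx ^^ j) (dx \<eta>) x *\<^sub>R f x) = (-1) ^ j *\<^sub>R (LINT x|lborel. dx \<eta> x *\<^sub>R D j x)"
      using weak[of j] j test_function_dx[OF \<eta>] by (simp add: has_weak_derivative_def)
    moreover have "(LINT x|lborel. (dx ^^ Suc j) \<eta> x *\<^sub>R f x) = (-1) ^ Suc j *\<^sub>R (LINT x|lborel. \<eta> x *\<^sub>R D (Suc j) x)"
      using weak[of "Suc j"] j \<eta> unfolding has_weak_derivative_def by auto
    ultimately have "(-1) ^ j *\<^sub>R (LINT x|lborel. dx \<eta> x *\<^sub>R D j x) = (-1) ^ j *\<^sub>R (- (LINT x|lborel. \<eta> x *\<^sub>R D (Suc j) x))"
      by (simp only: funpow_Suc_right comp_apply) simp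
    then show "(LINT x|lborel. dx \<eta> x *\<^sub>R D j x) = - (LINT x|lborel. \<eta> x *\<^sub>R D (Suc j) x)"
      by (subst (asm) real_vector.scale_left_imp_eq[rotated]) auto
  qed
  then obtain h where h: "AE x in lborel. D 0 x = h x" "Hk_bound k h B" by blast
  have "AE x in lborel. f x - D 0 x = 0"
  proof (rule AE_zero_of_test_functions)
    show "locally_integrable (\<lambda>x. f x - D 0 x)" by (intro locally_integrable_diff f li) simp
    fix \<eta> assume \<eta>: "test_function \<eta>"
    have "(LINT x|lborel. \<eta> x *\<^sub>R f x) = (LINT x|lborel. \<eta> x *\<^sub>R D 0 x)"
      using weak[of 0] \<eta> by (simp add: has_weak_derivative_def)
    then show "(LINT x|lborel. \<eta> x *\<^sub>R (f x - D 0 x)) = 0"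
      using test_function_integrable[OF \<eta> f] test_function_integrable[OF \<eta> li[of 0]]
      by (simp add: scaleR_diff_right)
  qed
  then have "AE x in lborel. f x = h x" using h(1) by eventually_elim simp
  then show thesis using that f h(2) by blast
qed

lemma sobolev_norm_nonneg: "0 \<le> sobolev_norm k f"
  unfolding sobolev_norm_def by (intro INF_greatest) (auto intro!: sum_nonneg)

lemma Hk_bound_diff:
  assumes f: "Hk_bound k f A" and g: "Hk_bound k g B"
  shows "Hk_bound k (\<lambda>x. f x - g x) (2 * (A + 4 ^ k * B))"
proof -
  have "Hk_bound k (\<lambda>x. (- 1 :: real) *\<^sub>R g x) (4 ^ k * (norm (- 1 :: real) * B))"
    by (rule Hk_bound_prod[OF bounded_bilinear_scaleR _ Ck_bound_const g]) simp
  from Hk_bound_add[OF f this] show ?thesis by simp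
qed

section \<open>Regularity of the phase and of the wave\<close>

lemma continuous_AE_le_imp_le:
  fixes g :: "real \<Rightarrow> real"
  assumes "continuous_on UNIV g" "AE x in lborel. g x \<le> \<theta>"
  shows "g x \<le> \<theta>"
proof (rule ccontr)
  assume "\<not> g x \<le> \<theta>"
  have "open {x. \<theta> < g x}"
    using assms(1) by (intro open_Collect_less continuous_intros) 
  then obtain e where e: "e > 0" "ball x e \<subseteq> {x. \<theta> < g x}"
    using \<open>\<not> g x \<le> \<theta>\<close> unfolding open_contains_ball by (metis (mono_tags) mem_Collect_eq not_le)
  have "AE y in lborel. y \<notin> {x - e<..<x + e}"
    using assms(2)
  proof eventually_elim
    case (elim y)
    show ?case
    proof
      assume "y \<in> {x - e<..<x + e}"
      then have "y \<in> ball x e" by (auto simp: dist_real_def)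
      then show False using e(2) elim by auto
    qed
  qed
  then have "{x - e<..<x + e} \<in> null_sets lborel"
    by (subst (asm) AE_iff_null_sets[symmetric]) auto
  then have "emeasure lborel {x - e<..<x + e} = 0" by blast
  then show False using e(1) by simp
qed

text \<open>
  An everywhere existing derivative that is locally integrable integrates back to \<open>\<gamma>\<close>. Hence \<open>\<gamma>\<close> is also
  the indefinite integral of the continuous representative \<open>g\<close> of its derivative, so that
  \<open>deriv \<gamma> = g\<close> holds at every point, and the almost everywhere bound \<open>\<theta>\<close> extends by continuity.
\<close>

lemma phase_derivative_regular:
  fixes \<gamma> :: "real \<Rightarrow> real"
  assumes diff: "\<And>x. \<gamma> differentiable (at x)"
    and Linf: "Linf_norm (deriv \<gamma>) \<le> ereal \<theta>"
    and sob: "sobolev_norm (Suc k) (deriv \<gamma>) < ereal G"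
  shows "(\<gamma> has_vector_derivative deriv \<gamma> x) (at x)" "Hk_bound (Suc k) (deriv \<gamma>) G"
    "\<bar>deriv \<gamma> x\<bar> \<le> \<theta>"
proof -
  have d: "(\<gamma> has_real_derivative deriv \<gamma> x) (at x)" for x
    using diff[of x] by (simp add: DERIV_deriv_iff_real_differentiable)
  obtain g where li: "locally_integrable (deriv \<gamma>)" and eq: "AE x in lborel. deriv \<gamma> x = g x"
    and g: "Hk_bound (Suc k) g G"
    using sobolev_norm_less_imp[OF sob] by blast
  have cont: "continuous_on UNIV g" by (rule Ck_bound_continuous[OF Hk_bound_imp_Ck_bound[OF g]])
  have [measurable]: "deriv \<gamma> \<in> borel_measurable borel" "g \<in> borel_measurable borel"
    using locally_integrable_measurable[OF li] Hk_bound_measurable[OF g] by auto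
  have "ac_deriv \<gamma> g"
    unfolding ac_deriv_def
  proof (intro conjI allI impI)
    show "locally_integrable g" by (rule locally_integrable_continuous[OF cont])
    fix x y :: real assume xy: "x \<le> y"
    have "(deriv \<gamma> has_integral \<gamma> y - \<gamma> x) {x..y}"
      using xy d by (intro fundamental_theorem_of_calculus)
        (auto simp: has_real_derivative_iff_has_vector_derivative intro: has_vector_derivative_at_within)
    then have "\<gamma> y - \<gamma> x = integral {x..y} (deriv \<gamma>)" by (simp add: integral_unique)
    also have "\<dots> = (LINT t:{x..y}|lborel. deriv \<gamma> t)"
      using li by (intro set_borel_integral_eq_integral(2)[symmetric]) (simp add: locally_integrable_def)
    also have "\<dots> = (LINT t:{x..y}|lborel. g t)"
      unfolding set_lebesgue_integral_def
    proof (rule integral_cong_AE)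
      show "AE t in lborel. indicat_real {x..y} t *\<^sub>R deriv \<gamma> t = indicat_real {x..y} t *\<^sub>R g t"
        using eq by eventually_elim simp
    qed auto
    finally show "\<gamma> y - \<gamma> x = (LINT t:{x..y}|lborel. g t)" .
  qed
  then have v: "(\<gamma> has_vector_derivative g x) (at x)" for x
    by (rule ac_deriv_has_vector_derivative[OF _ cont])
  then have dg: "deriv \<gamma> = g"
    by (intro ext DERIV_imp_deriv) (simp add: has_real_derivative_iff_has_vector_derivative)
  show "(\<gamma> has_vector_derivative deriv \<gamma> x) (at x)" "Hk_bound (Suc k) (deriv \<gamma>) G"
    using v g by (simp_all add: dg)
  have "AE x in lborel. ereal (norm (deriv \<gamma> x)) \<le> Linf_norm (deriv \<gamma>)"
    unfolding Linf_norm_def by (rule esssup_AE)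
  then have "AE x in lborel. \<bar>g x\<bar> \<le> \<theta>"
  proof eventually_elim
    case (elim x)
    from order_trans[OF elim Linf] show ?case by (simp add: dg)
  qed
  then show "\<bar>deriv \<gamma> x\<bar> \<le> \<theta>"
    unfolding dg by (intro continuous_AE_le_imp_le[of "\<lambda>x. \<bar>g x\<bar>"] continuous_intros cont)
qed

lemma periodic_bounded:
  fixes \<phi> :: "real \<Rightarrow> 'a::real_normed_vector"
  assumes cont: "continuous_on UNIV \<phi>" and P: "P > 0" and per: "\<And>x. \<phi> (x + P) = \<phi> x"
  shows "\<exists>L. \<forall>x. norm (\<phi> x) \<le> L"
proof -
  interpret periodic_fun_simple \<phi> P by standard (rule per)
  have "bounded (\<phi> ` {0..P})"
    by (intro compact_imp_bounded compact_continuous_image compact_Icc continuous_on_subset[OF cont]) auto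
  then obtain L where L: "\<And>x. x \<in> {0..P} \<Longrightarrow> norm (\<phi> x) \<le> L"
    unfolding bounded_iff by (metis image_eqI)
  have "norm (\<phi> x) \<le> L" for x
  proof -
    let ?n = "\<lfloor>x / P\<rfloor>"
    have "of_int ?n * P \<le> x" using P floor_le_iff[of "x / P"] by (metis floor_divide_lower)
    moreover have "x \<le> (of_int ?n + 1) * P" using floor_divide_upper[OF P, of x] by simp
    ultimately have "x - of_int ?n * P \<in> {0..P}" by (simp add: algebra_simps)
    moreover have "\<phi> (x - of_int ?n * P) = \<phi> x" by (rule minus_of_int)
    ultimately show ?thesis using L by metis
  qed
  then show ?thesis by blast
qed

lemma smooth_periodic_Ck_bound:
  fixes \<phi> :: "real \<Rightarrow> 'a::euclidean_space"
  assumes "smooth \<phi>" and P: "P > 0" and "\<And>x. \<phi> (x + P) = \<phi> x"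
  shows "\<exists>L. Ck_bound k \<phi> L"
  using assms(1,3)
proof (induction k arbitrary: \<phi>)
  case 0
  then show ?case using periodic_bounded[OF smooth_continuous[OF 0(1)] P 0(2)] smooth_continuous by auto
next
  case (Suc k)
  have d: "(\<phi> has_vector_derivative dx \<phi> x) (at x)" for x
    by (rule smooth_has_vector_derivative[OF Suc.prems(1)])
  have "dx \<phi> (x + P) = dx \<phi> x" for x
  proof -
    have "((\<lambda>x. x + P) has_vector_derivative 1) (at x)" by (auto intro!: derivative_eq_intros)
    from vector_diff_chain_at[OF this d] have "(\<phi> has_vector_derivative dx \<phi> (x + P)) (at x)"
      using Suc.prems(2) by (simp add: o_def)
    then show ?thesis by (rule vector_derivative_unique_at[OF _ d])
  qed
  then obtain L where L: "Ck_bound k (dx \<phi>) L" using Suc.IH[OF smooth_dx[OF Suc.prems(1)]] by blast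
  obtain L' where L': "\<And>x. norm (\<phi> x) \<le> L'"
    using periodic_bounded[OF smooth_continuous[OF Suc.prems(1)] P Suc.prems(2)] by blast
  have "Ck_bound (Suc k) \<phi> (max L' L)"
    using L' by (intro Ck_bound_SucI[OF _ d L]) (auto simp: le_max_iff_disj)
  then show ?case by blast
qed

section \<open>Comparison of the two modulations\<close>

lemma phase_diffeo:
  fixes \<gamma> g :: "real \<Rightarrow> real"
  assumes \<theta>: "\<theta> < 1" and \<gamma>: "\<And>x. (\<gamma> has_vector_derivative g x) (at x)"
    and g: "Ck_bound k g K" and le: "\<And>x. \<bar>g x\<bar> \<le> \<theta>"
  shows "line_diffeo (1 - \<theta>) (\<lambda>x. x - \<gamma> x) (\<lambda>x. 1 - g x)" "Ck_bound k (\<lambda>x. 1 - g x) (1 + K)"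
proof -
  show "line_diffeo (1 - \<theta>) (\<lambda>x. x - \<gamma> x) (\<lambda>x. 1 - g x)"
    unfolding line_diffeo_def
  proof (intro conjI allI)
    show "1 - \<theta> > 0" using \<theta> by simp
    show "((\<lambda>x. x - \<gamma> x) has_vector_derivative 1 - g x) (at x)" for x
      by (intro has_vector_derivative_diff has_vector_derivative_id \<gamma>)
    show "continuous_on UNIV (\<lambda>x. 1 - g x)"
      by (intro continuous_intros Ck_bound_continuous[OF g])
    show "1 - \<theta> \<le> 1 - g x" for x using le[of x] by simp
  qed
  show "Ck_bound k (\<lambda>x. 1 - g x) (1 + K)"
    using Ck_bound_add[OF Ck_bound_const[of k "1::real"] Ck_bound_minus[OF g]] by simp
qed

text \<open>
  With \<open>a = Id - \<gamma>\<close> and \<open>c = a + \<gamma> \<circ> a\<close>, the displacement \<open>c - Id\<close> is \<open>\<gamma> \<circ> a - \<gamma>\<close>, and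
  \<open>c' - 1 = a' \<cdot> (g \<circ> a) - g\<close> is bounded in \<open>H\<^sup>k\<close> by \<open>g\<close>.
\<close>

lemma Hk_bound_phase_remainder:
  fixes \<phi> :: "real \<Rightarrow> 'a::euclidean_space"
  assumes \<theta>: "\<theta> < 1" and M: "0 \<le> M" and \<phi>: "Ck_bound (Suc k) \<phi> L"
  shows "\<exists>C\<ge>0. \<forall>(\<gamma> :: real \<Rightarrow> real) g G. (\<forall>x. (\<gamma> has_vector_derivative g x) (at x)) \<longrightarrow>
     (\<forall>x. \<bar>\<gamma> x\<bar> \<le> M) \<longrightarrow> (\<forall>x. \<bar>g x\<bar> \<le> \<theta>) \<longrightarrow> Ck_bound k g K \<longrightarrow> Hk_bound k g G \<longrightarrow>
     Hk_bound k (\<lambda>x. \<phi> (x - \<gamma> x + \<gamma> (x - \<gamma> x)) - \<phi> x) (C * G)"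
proof -
  have "1 - \<theta> > 0" using \<theta> by simp
  from Hk_bound_comp[OF this, of k "1 + K", where 'a = real]
  obtain A where A: "A \<ge> 0" "\<And>a a' (f :: real \<Rightarrow> real) B. line_diffeo (1 - \<theta>) a a' \<Longrightarrow>
    Ck_bound k a' (1 + K) \<Longrightarrow> Hk_bound k f B \<Longrightarrow> Hk_bound k (\<lambda>x. f (a x)) (A * B)" by blast
  obtain E where E: "\<And>(f :: real \<Rightarrow> real) a a'. Ck_bound k f K \<Longrightarrow>
      (\<And>x. (a has_vector_derivative a' x) (at x)) \<Longrightarrow> Ck_bound k a' (1 + K) \<Longrightarrow> Ck_bound k (\<lambda>x. f (a x)) E"
    using Ck_bound_comp[of k K "1 + K", where 'a = real] by blast
  define K' where "K' = (1 + K) + 2 ^ k * ((1 + K) * E)"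
  obtain C where C: "C \<ge> 0" "\<And>c c' B. (\<And>x. (c has_vector_derivative c' x) (at x)) \<Longrightarrow> Ck_bound k c' K' \<Longrightarrow>
     L2_bound (\<lambda>x. c x - x) B \<Longrightarrow> Hk_bound k (\<lambda>x. c' x - 1) B \<Longrightarrow>
     Hk_bound k (\<lambda>x. \<phi> (c x) - \<phi> x) (C * B)"
    using Hk_bound_comp_near_id[OF \<phi>, of K'] by blast
  define D where "D = max (2 * M) (2 * (4 ^ k * ((1 + K) * A) + 4 ^ k))"
  have "2 * M \<le> D" by (simp add: D_def)
  then have D0: "0 \<le> D" using M by linarith
  show ?thesis
  proof (intro exI[of _ "C * D"] conjI allI impI)
    show "0 \<le> C * D" using C D0 by simp
    fix \<gamma> g :: "real \<Rightarrow> real" and G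
    assume \<gamma>: "\<forall>x. (\<gamma> has_vector_derivative g x) (at x)" "\<forall>x. \<bar>\<gamma> x\<bar> \<le> M"
      and g: "\<forall>x. \<bar>g x\<bar> \<le> \<theta>" "Ck_bound k g K" "Hk_bound k g G"
    define a a' where "a = (\<lambda>x. x - \<gamma> x)" and "a' = (\<lambda>x. 1 - g x)"
    have a: "line_diffeo (1 - \<theta>) a a'" and a': "Ck_bound k a' (1 + K)"
      unfolding a_def a'_def using phase_diffeo[OF \<theta> _ g(2)] \<gamma>(1) g(1) by blast+
    have da: "(a has_vector_derivative a' x) (at x)" for x using a by (simp add: line_diffeo_def)
    have G: "0 \<le> G" by (rule Hk_bound_nonneg[OF g(3)])
    define c c' where "c = (\<lambda>x. a x + \<gamma> (a x))" and "c' = (\<lambda>x. a' x + a' x *\<^sub>R g (a x))"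
    have "(c has_vector_derivative c' x) (at x)" for x
      unfolding c_def c'_def
      using vector_diff_chain_at[OF da \<gamma>(1)[rule_format]]
      by (intro has_vector_derivative_add da) (simp add: o_def)
    moreover have "Ck_bound k c' K'"
      unfolding c'_def K'_def by (intro Ck_bound_add a' Ck_bound_scaleR E[OF g(2) da a'])
    moreover have "L2_bound (\<lambda>x. c x - x) (D * G)"
    proof -
      have ac: "ac_deriv \<gamma> g" using \<gamma>(1) by (intro ac_deriv_C1 Ck_bound_continuous[OF g(2)]) auto
      have "L2_bound (\<lambda>x. \<gamma> x - \<gamma> (a x)) (2 * M * G)"
        using \<gamma>(2) by (intro L2_bound_displacement[OF ac Hk_bound_L2[OF g(3)] M] line_diffeo_measurable[OF a])
          (simp add: a_def)
      then have "L2_bound (\<lambda>x. c x - x) (1 * (2 * M * G))"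
        by (rule L2_bound_dominated)
           (auto simp: c_def a_def abs_minus_commute intro!: borel_measurable_continuous_onI continuous_intros
             continuous_on_compose2[OF ac_deriv_continuous[OF ac]] ac_deriv_continuous[OF ac])
      then show ?thesis
        using mult_right_mono[OF \<open>2 * M \<le> D\<close> G] by (elim L2_bound_mono) simp
    qed
    moreover have "Hk_bound k (\<lambda>x. c' x - 1) (D * G)"
    proof -
      have "Hk_bound k (\<lambda>x. a' x *\<^sub>R g (a x)) (4 ^ k * ((1 + K) * (A * G)))"
        by (intro Hk_bound_prod[OF bounded_bilinear_scaleR _ a'] A(2)[OF a a' g(3)]) (simp add: abs_mult)
      from Hk_bound_diff[OF this g(3)]
      have "Hk_bound k (\<lambda>x. c' x - 1) (2 * (4 ^ k * ((1 + K) * (A * G)) + 4 ^ k * G))"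
        by (simp add: c'_def a'_def algebra_simps)
      then show ?thesis
      proof (rule Hk_bound_mono)
        have "2 * (4 ^ k * ((1 + K) * (A * G)) + 4 ^ k * G) = 2 * (4 ^ k * ((1 + K) * A) + 4 ^ k) * G"
          by (simp add: algebra_simps)
        also have "\<dots> \<le> D * G" unfolding D_def by (rule mult_right_mono[OF max.cobounded2 G])
        finally show "2 * (4 ^ k * ((1 + K) * (A * G)) + 4 ^ k * G) \<le> D * G" .
      qed
    qed
    ultimately have "Hk_bound k (\<lambda>x. \<phi> (c x) - \<phi> x) (C * (D * G))" by (rule C(2))
    then show "Hk_bound k (\<lambda>x. \<phi> (x - \<gamma> x + \<gamma> (x - \<gamma> x)) - \<phi> x) (C * D * G)"
      by (simp add: c_def a_def mult.assoc)
  qed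
qed

text \<open>
  The identities \<open>v = w \<circ> a + r\<close> and \<open>w = (v - r) \<circ> b\<close>, where \<open>b\<close> is the inverse of \<open>a\<close>, transport good
  representatives in both directions; null sets are respected by \<open>a\<close> and \<open>b\<close>.
\<close>

lemma modulated_sobolev_norm_le:
  fixes \<phi> :: "real \<Rightarrow> 'a::euclidean_space"
  assumes \<theta>: "\<theta> < 1" and M: "0 \<le> M" and \<phi>: "Ck_bound (Suc k) \<phi> L" and K: "0 \<le> K"
  shows "\<exists>C>0. \<forall>(\<gamma> :: real \<Rightarrow> real) g G (\<psi> :: real \<Rightarrow> 'a) W.
     (\<forall>x. (\<gamma> has_vector_derivative g x) (at x)) \<longrightarrow>
     (\<forall>x. \<bar>\<gamma> x\<bar> \<le> M) \<longrightarrow> (\<forall>x. \<bar>g x\<bar> \<le> \<theta>) \<longrightarrow> Ck_bound k g K \<longrightarrow> Hk_bound k g G \<longrightarrow>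
     (sobolev_norm k (\<lambda>x. \<psi> x - \<phi> (x + \<gamma> x)) < ereal W \<longrightarrow>
        sobolev_norm k (\<lambda>x. \<psi> (x - \<gamma> x) - \<phi> x) \<le> ereal (C * (W + G))) \<and>
     (sobolev_norm k (\<lambda>x. \<psi> (x - \<gamma> x) - \<phi> x) < ereal W \<longrightarrow>
        sobolev_norm k (\<lambda>x. \<psi> x - \<phi> (x + \<gamma> x)) \<le> ereal (C * (W + G)))"
proof -
  have c: "1 - \<theta> > 0" using \<theta> by simp
  have K1: "inverse (1 + K) > 0" using K by simp
  obtain A where A: "A \<ge> 0" "\<And>a a' (f :: real \<Rightarrow> 'a) B. line_diffeo (1 - \<theta>) a a' \<Longrightarrow>
    Ck_bound k a' (1 + K) \<Longrightarrow> Hk_bound k f B \<Longrightarrow> Hk_bound k (\<lambda>x. f (a x)) (A * B)"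
    using Hk_bound_comp[OF c, of k "1 + K", where 'a = 'a] by blast
  obtain Kb where Kb: "\<And>a' b b'. Ck_bound k a' (1 + K) \<Longrightarrow> (\<And>x. 1 - \<theta> \<le> a' x) \<Longrightarrow>
     (\<And>y. (b has_vector_derivative b' y) (at y)) \<Longrightarrow> (\<And>y. b' y = inverse (a' (b y))) \<Longrightarrow> Ck_bound k b' Kb"
    using Ck_bound_inverse_function_deriv[OF c, of k "1 + K"] by blast
  obtain B where B: "B \<ge> 0" "\<And>a a' (f :: real \<Rightarrow> 'a) W. line_diffeo (inverse (1 + K)) a a' \<Longrightarrow>
    Ck_bound k a' Kb \<Longrightarrow> Hk_bound k f W \<Longrightarrow> Hk_bound k (\<lambda>x. f (a x)) (B * W)"
    using Hk_bound_comp[OF K1, of k Kb, where 'a = 'a] by blast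
  obtain R where R: "R \<ge> 0" "\<And>(\<gamma> :: real \<Rightarrow> real) g G. (\<And>x. (\<gamma> has_vector_derivative g x) (at x)) \<Longrightarrow>
     (\<And>x. \<bar>\<gamma> x\<bar> \<le> M) \<Longrightarrow> (\<And>x. \<bar>g x\<bar> \<le> \<theta>) \<Longrightarrow> Ck_bound k g K \<Longrightarrow> Hk_bound k g G \<Longrightarrow>
     Hk_bound k (\<lambda>x. \<phi> (x - \<gamma> x + \<gamma> (x - \<gamma> x)) - \<phi> x) (R * G)"
    using Hk_bound_phase_remainder[OF \<theta> M \<phi>, of K] by blast
  define C1 where "C1 = real (Suc k) * (2 * (A + R))"
  define C2 where "C2 = real (Suc k) * (B * (2 * (1 + 4 ^ k * R)))"
  have C12: "0 \<le> C1" "0 \<le> C2" unfolding C1_def C2_def using A(1) B(1) R(1) by auto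
  define C where "C = 1 + C1 + C2"
  show ?thesis
  proof (intro exI[of _ C] conjI allI impI)
    show "C > 0" using C12 by (simp add: C_def)
    fix \<gamma> g :: "real \<Rightarrow> real" and G and \<psi> :: "real \<Rightarrow> 'a" and W
    assume \<gamma>: "\<forall>x. (\<gamma> has_vector_derivative g x) (at x)" "\<forall>x. \<bar>\<gamma> x\<bar> \<le> M"
      and g: "\<forall>x. \<bar>g x\<bar> \<le> \<theta>" "Ck_bound k g K" "Hk_bound k g G"
    define a a' where "a = (\<lambda>x. x - \<gamma> x)" and "a' = (\<lambda>x. 1 - g x)"
    have a: "line_diffeo (1 - \<theta>) a a'" and a': "Ck_bound k a' (1 + K)"
      unfolding a_def a'_def using phase_diffeo[OF \<theta> _ g(2)] \<gamma>(1) g(1) by blast+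
    have G: "0 \<le> G" by (rule Hk_bound_nonneg[OF g(3)])
    define r where "r = (\<lambda>x. \<phi> (a x + \<gamma> (a x)) - \<phi> x)"
    have r: "Hk_bound k r (R * G)" unfolding r_def a_def using \<gamma> g by (intro R(2)) auto
    define v where "v = (\<lambda>x. \<psi> (a x) - \<phi> x)"
    define w where "w = (\<lambda>x. \<psi> x - \<phi> (x + \<gamma> x))"
    note [measurable] = line_diffeo_measurable[OF a] Hk_bound_measurable[OF r]
    {
      assume less: "sobolev_norm k (\<lambda>x. \<psi> x - \<phi> (x + \<gamma> x)) < ereal W"
      obtain h where w: "locally_integrable w" "AE x in lborel. w x = h x" "Hk_bound k h W"
        using sobolev_norm_less_imp[OF less] unfolding w_def by blast
      have W: "0 \<le> W" by (rule Hk_bound_nonneg[OF w(3)])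
      have [measurable]: "w \<in> borel_measurable borel" by (rule locally_integrable_measurable[OF w(1)])
      have v: "v = (\<lambda>x. w (a x) + r x)" by (simp add: v_def w_def r_def)
      have "Hk_bound k (\<lambda>x. h (a x) + r x) (2 * (A * W + R * G))"
        by (intro Hk_bound_add A(2)[OF a a' w(3)] r)
      moreover have "v \<in> borel_measurable borel" unfolding v by measurable
      moreover have "AE x in lborel. h (a x) + r x = v x"
        using line_diffeo_AE[OF a w(2)] unfolding v by eventually_elim simp
      ultimately have "sobolev_norm k v \<le> ereal (real (Suc k) * (2 * (A * W + R * G)))"
        by (rule sobolev_norm_le)
      also have "\<dots> \<le> ereal (C * (W + G))"
      proof -
        have "A * W + R * G \<le> (A + R) * (W + G)"
          using A(1) R(1) W G by (simp add: algebra_simps)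
        then have "real (Suc k) * (2 * (A * W + R * G)) \<le> real (Suc k) * (2 * ((A + R) * (W + G)))"
          by (intro mult_left_mono) auto
        also have "\<dots> = C1 * (W + G)" by (simp add: C1_def)
        also have "\<dots> \<le> C * (W + G)" using C12 W G by (intro mult_right_mono) (auto simp: C_def)
        finally show ?thesis by simp
      qed
      finally show "sobolev_norm k (\<lambda>x. \<psi> (x - \<gamma> x) - \<phi> x) \<le> ereal (C * (W + G))"
        by (simp add: v_def a_def)
    next
      assume less: "sobolev_norm k (\<lambda>x. \<psi> (x - \<gamma> x) - \<phi> x) < ereal W"
      obtain h where v: "locally_integrable v" "AE x in lborel. v x = h x" "Hk_bound k h W"
        using sobolev_norm_less_imp[OF less] unfolding v_def a_def by blast
      have W: "0 \<le> W" by (rule Hk_bound_nonneg[OF v(3)])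
      have [measurable]: "v \<in> borel_measurable borel" by (rule locally_integrable_measurable[OF v(1)])
      obtain b where b: "\<And>x. b (a x) = x" "\<And>y. a (b y) = y"
        "\<And>y. (b has_vector_derivative inverse (a' (b y))) (at y)"
        using line_diffeo_inverse[OF a] by blast
      define b' where "b' = (\<lambda>y. inverse (a' (b y)))"
      have b'k: "Ck_bound k b' Kb"
        using a b(3) by (intro Kb[OF a', of b]) (auto simp: b'_def line_diffeo_def)
      have bd: "line_diffeo (inverse (1 + K)) b b'"
        unfolding line_diffeo_def
      proof (intro conjI allI K1)
        show "(b has_vector_derivative b' y) (at y)" for y using b(3) by (simp add: b'_def)
        show "continuous_on UNIV b'" by (rule Ck_bound_continuous[OF b'k])
        show "inverse (1 + K) \<le> b' y" for y
          unfolding b'_def using line_diffeo_pos[OF a, of "b y"] Ck_bound_norm[OF a', of "b y"]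
          by (intro le_imp_inverse_le) auto
      qed
      note [measurable] = line_diffeo_measurable(1)[OF bd]
      have w: "w = (\<lambda>y. v (b y) - r (b y))" by (simp add: v_def w_def r_def b)
      have "Hk_bound k (\<lambda>x. h x - r x) (2 * (W + 4 ^ k * (R * G)))"
        by (rule Hk_bound_diff[OF v(3) r])
      from B(2)[OF bd b'k this]
      have "Hk_bound k (\<lambda>y. h (b y) - r (b y)) (B * (2 * (W + 4 ^ k * (R * G))))" .
      moreover have "w \<in> borel_measurable borel" unfolding w by measurable
      moreover have "AE y in lborel. h (b y) - r (b y) = w y"
        using line_diffeo_AE[OF bd v(2)] unfolding w by eventually_elim simp
      ultimately have "sobolev_norm k w \<le> ereal (real (Suc k) * (B * (2 * (W + 4 ^ k * (R * G)))))"
        by (rule sobolev_norm_le)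
      also have "\<dots> \<le> ereal (C * (W + G))"
      proof -
        have "W + 4 ^ k * (R * G) \<le> (1 + 4 ^ k * R) * (W + G)"
          using R(1) W G by (simp add: algebra_simps)
        then have "real (Suc k) * (B * (2 * (W + 4 ^ k * (R * G))))
            \<le> real (Suc k) * (B * (2 * ((1 + 4 ^ k * R) * (W + G))))"
          using B(1) by (intro mult_left_mono) auto
        also have "\<dots> = C2 * (W + G)" by (simp add: C2_def mult.assoc)
        also have "\<dots> \<le> C * (W + G)" using C12 W G by (intro mult_right_mono) (auto simp: C_def)
        finally show ?thesis by simp
      qed
      finally show "sobolev_norm k (\<lambda>x. \<psi> x - \<phi> (x + \<gamma> x)) \<le> ereal (C * (W + G))"
        by (simp add: w_def)
    }
  qed
qed

text \<open>
  Representatives are available only below strict upper bounds of the norms; letting these bounds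
  decrease recovers the norms themselves. The restriction \<open>G \<le> g0 + 1\<close> keeps \<open>G\<close> below a fixed constant.
\<close>

lemma ereal_le_of_strict_bounds:
  fixes x z :: ereal and g0 :: real
  assumes C: "C > 0" and x: "0 \<le> x"
    and le: "\<And>W G. x < ereal W \<Longrightarrow> g0 < G \<Longrightarrow> G \<le> g0 + 1 \<Longrightarrow> z \<le> ereal (C * (W + G))"
  shows "z \<le> ereal C * (x + ereal g0)"
proof (cases x)
  case (real x0)
  have "z \<le> ereal C * (x + ereal g0) + ereal e" if "e > 0" for e
  proof -
    define d where "d = min 1 (e / (2 * C))"
    have d: "d > 0" "d \<le> 1" using that C by (auto simp: d_def)
    have "d \<le> e / (2 * C)" by (simp add: d_def)
    then have dC: "2 * C * d \<le> e" using C by (simp add: field_simps)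
    have "z \<le> ereal (C * ((x0 + d) + (g0 + d)))"
      using d real by (intro le) auto
    also have "\<dots> \<le> ereal (C * (x0 + g0) + e)" using dC by (simp add: algebra_simps)
    finally show ?thesis using real by simp
  qed
  then show ?thesis by (rule ereal_le_epsilon2)
next
  case PInf
  then show ?thesis using C by simp
next
  case MInf
  then show ?thesis using x by simp
qed

theorem corollary5p3:
  fixes k :: nat and \<alpha> \<beta> F C1 M \<theta> :: real and \<phi> :: "real \<Rightarrow> complex"
  assumes "F > 0"
    and "LLE_steady_periodic \<alpha> \<beta> F \<phi>"
    and "\<theta> < 1"
  shows "\<exists>C>0. \<forall>(\<gamma> :: real \<Rightarrow> real) (\<psi> :: real \<Rightarrow> real \<Rightarrow> complex) T t.
           LLE_solution \<alpha> \<beta> F T \<psi> \<longrightarrow> t \<in> {0..<T} \<longrightarrow>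
           (\<forall>x. \<gamma> differentiable (at x)) \<longrightarrow>
           (\<forall>x. \<bar>\<gamma> x\<bar> \<le> M) \<longrightarrow>
           Linf_norm (deriv \<gamma>) \<le> ereal \<theta> \<longrightarrow>
           sobolev_norm (k + 1) (deriv \<gamma>) \<le> ereal C1 \<longrightarrow>
             ereal (inverse C) * sobolev_norm k (\<lambda>x. \<psi> t (x - \<gamma> x) - \<phi> x)
               - sobolev_norm (k + 1) (deriv \<gamma>)
             \<le> sobolev_norm k (\<lambda>x. \<psi> t x - \<phi> (x + \<gamma> x)) \<and>
             sobolev_norm k (\<lambda>x. \<psi> t x - \<phi> (x + \<gamma> x))
             \<le> ereal C * (sobolev_norm k (\<lambda>x. \<psi> t (x - \<gamma> x) - \<phi> x)
                 + sobolev_norm (k + 1) (deriv \<gamma>))"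
proof -
  obtain P where \<phi>: "smooth \<phi>" "P > 0" "\<And>x. \<phi> (x + P) = \<phi> x"
    using assms(2) unfolding LLE_steady_periodic_def by blast
  obtain L where L: "Ck_bound (Suc k) \<phi> L" using smooth_periodic_Ck_bound[OF \<phi>] by blast
  \<comment> \<open>a norm bound \<open>G \<le> C1 + 1\<close> for \<open>deriv \<gamma>\<close> gives the uniform bound \<open>2 * G\<close> on its derivatives\<close>
  define K where "K = 2 * (\<bar>C1\<bar> + 1)"
  have K: "0 \<le> K" by (simp add: K_def)
  obtain C where C: "C > 0" and fwd: "\<And>(\<gamma> :: real \<Rightarrow> real) g G (\<psi> :: real \<Rightarrow> complex) W.
     (\<And>x. (\<gamma> has_vector_derivative g x) (at x)) \<Longrightarrow>
     (\<And>x. \<bar>\<gamma> x\<bar> \<le> \<bar>M\<bar>) \<Longrightarrow> (\<And>x. \<bar>g x\<bar> \<le> \<theta>) \<Longrightarrow> Ck_bound k g K \<Longrightarrow> Hk_bound k g G \<Longrightarrow>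
     sobolev_norm k (\<lambda>x. \<psi> x - \<phi> (x + \<gamma> x)) < ereal W \<Longrightarrow>
     sobolev_norm k (\<lambda>x. \<psi> (x - \<gamma> x) - \<phi> x) \<le> ereal (C * (W + G))"
   and bwd: "\<And>(\<gamma> :: real \<Rightarrow> real) g G (\<psi> :: real \<Rightarrow> complex) W.
     (\<And>x. (\<gamma> has_vector_derivative g x) (at x)) \<Longrightarrow>
     (\<And>x. \<bar>\<gamma> x\<bar> \<le> \<bar>M\<bar>) \<Longrightarrow> (\<And>x. \<bar>g x\<bar> \<le> \<theta>) \<Longrightarrow> Ck_bound k g K \<Longrightarrow> Hk_bound k g G \<Longrightarrow>
     sobolev_norm k (\<lambda>x. \<psi> (x - \<gamma> x) - \<phi> x) < ereal W \<Longrightarrow>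
     sobolev_norm k (\<lambda>x. \<psi> x - \<phi> (x + \<gamma> x)) \<le> ereal (C * (W + G))"
    using modulated_sobolev_norm_le[OF assms(3) abs_ge_zero[of M] L K] by blast
  show ?thesis
  proof (intro exI[of _ C] conjI allI impI C)
    fix \<gamma> :: "real \<Rightarrow> real" and \<psi> :: "real \<Rightarrow> real \<Rightarrow> complex" and T t :: real
    assume diff: "\<forall>x. \<gamma> differentiable (at x)" and M: "\<forall>x. \<bar>\<gamma> x\<bar> \<le> M"
      and Linf: "Linf_norm (deriv \<gamma>) \<le> ereal \<theta>"
      and sob: "sobolev_norm (k + 1) (deriv \<gamma>) \<le> ereal C1"
    let ?v = "\<lambda>x. \<psi> t (x - \<gamma> x) - \<phi> x" and ?w = "\<lambda>x. \<psi> t x - \<phi> (x + \<gamma> x)"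
    obtain g0 where g0: "sobolev_norm (k + 1) (deriv \<gamma>) = ereal g0" "g0 \<le> C1"
      using sob sobolev_norm_nonneg[of "k + 1" "deriv \<gamma>"]
      by (cases "sobolev_norm (k + 1) (deriv \<gamma>)") auto
    have reg: "(\<gamma> has_vector_derivative deriv \<gamma> x) (at x)" "\<bar>\<gamma> x\<bar> \<le> \<bar>M\<bar>" "\<bar>deriv \<gamma> x\<bar> \<le> \<theta>"
      "Ck_bound k (deriv \<gamma>) K" "Hk_bound k (deriv \<gamma>) G"
      if G: "g0 < G" "G \<le> g0 + 1" for G x
    proof -
      have "sobolev_norm (Suc k) (deriv \<gamma>) < ereal G" using g0 G by simp
      note * = phase_derivative_regular[OF _ Linf this]
      show "(\<gamma> has_vector_derivative deriv \<gamma> x) (at x)" "\<bar>deriv \<gamma> x\<bar> \<le> \<theta>" using * diff by blast+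
      have H: "Hk_bound (Suc k) (deriv \<gamma>) G" using * diff by blast
      show "Hk_bound k (deriv \<gamma>) G" by (rule Hk_bound_Suc_imp[OF H])
      show "Ck_bound k (deriv \<gamma>) K"
        using g0 G by (intro Ck_bound_mono[OF Hk_bound_imp_Ck_bound[OF H]]) (simp add: K_def)
      show "\<bar>\<gamma> x\<bar> \<le> \<bar>M\<bar>" using M[rule_format, of x] by linarith
    qed
    show "sobolev_norm k ?w \<le> ereal C * (sobolev_norm k ?v + sobolev_norm (k + 1) (deriv \<gamma>))"
      unfolding g0(1)
    proof (rule ereal_le_of_strict_bounds[OF C sobolev_norm_nonneg])
      fix W G assume "sobolev_norm k ?v < ereal W" "g0 < G" "G \<le> g0 + 1"
      then show "sobolev_norm k ?w \<le> ereal (C * (W + G))" by (intro bwd[of \<gamma> "deriv \<gamma>"] reg)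
    qed
    have "sobolev_norm k ?v \<le> ereal C * (sobolev_norm k ?w + ereal g0)"
    proof (rule ereal_le_of_strict_bounds[OF C sobolev_norm_nonneg])
      fix W G assume "sobolev_norm k ?w < ereal W" "g0 < G" "G \<le> g0 + 1"
      then show "sobolev_norm k ?v \<le> ereal (C * (W + G))" by (intro fwd[of \<gamma> "deriv \<gamma>"] reg)
    qed
    then have "ereal (inverse C) * sobolev_norm k ?v \<le> ereal (inverse C) * (ereal C * (sobolev_norm k ?w + ereal g0))"
      using C by (intro ereal_mult_left_mono) auto
    also have "\<dots> = sobolev_norm k ?w + ereal g0"
      using C by (simp add: mult.assoc[symmetric] one_ereal_def[symmetric])
    finally show "ereal (inverse C) * sobolev_norm k ?v - sobolev_norm (k + 1) (deriv \<gamma>) \<le> sobolev_norm k ?w"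
      unfolding g0(1) by (simp add: ereal_minus_le)
  qed
qed

end
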